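(* Let $p$ be a prime number, let $A$ be a non-trivial nilpotent $p$-group of finite exponent, and let $B$ be a non-trivial abelian group of finite exponent $p^v$. Then the wreath product $A\,\mathrm{Wr}\,B$ generates the variety $\mathrm{var}(A)\,\mathrm{var}(B)=\mathrm{var}(A)\,\mathfrak{A}_{p^v}$, that is, $$\mathrm{var}(A\,\mathrm{Wr}\,B)=\mathrm{var}(A)\,\mathrm{var}(B),$$ if and only if $B$ contains a subgroup isomorphic to the direct product $C_{p^v}^{\infty}$ of countably (infinitely) many copies of the cyclic group $C_{p^v}$ of order $p^v$.
   Context: $A\,\mathrm{Wr}\,B$ denotes the Cartesian (unrestricted) wreath product, i.e. the semidirect product of the full Cartesian power $A^B$ (all functions $B\to A$) by $B$ acting by shifting coordinates. For a group $X$, $\mathrm{var}(X)$ is the variety of groups generated by $X$. For varieties of groups $\mathfrak{U},\mathfrak{V}$, the product variety $\mathfrak{U}\mathfrak{V}$ consists of all groups $G$ having a normal subgroup $N\in\mathfrak{U}$ with $G/N\in\mathfrak{V}$. $\mathfrak{A}_{n}$ is the variety of all abelian groups of exponent dividing $n$. The direct product $C_{p^v}^{\infty}$ is the restricted one (elements of finite support). $B$ need not be finite, and $A$ need not be finite. *)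

theory Defs
  imports "HOL-Algebra.Product_Groups" "HOL-Computational_Algebra.Primes"
begin

section \<open>Nilpotency, exponent, p-groups\<close>

fun lower_central :: "('a, 'm) monoid_scheme \<Rightarrow> nat \<Rightarrow> 'a set" where
  "lower_central G 0 = carrier G"
| "lower_central G (Suc i) =
     generate G {x \<otimes>\<^bsub>G\<^esub> y \<otimes>\<^bsub>G\<^esub> inv\<^bsub>G\<^esub> x \<otimes>\<^bsub>G\<^esub> inv\<^bsub>G\<^esub> y | x y. x \<in> lower_central G i \<and> y \<in> carrier G}"

definition nilpotent_group :: "('a, 'm) monoid_scheme \<Rightarrow> bool" where
  "nilpotent_group G \<longleftrightarrow> group G \<and> (\<exists>c. lower_central G c = {\<one>\<^bsub>G\<^esub>})"

definition p_group :: "nat \<Rightarrow> ('a, 'm) monoid_scheme \<Rightarrow> bool" where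
  "p_group p G \<longleftrightarrow> group G \<and> (\<forall>x\<in>carrier G. \<exists>k::nat. x [^]\<^bsub>G\<^esub> (p ^ k) = \<one>\<^bsub>G\<^esub>)"

definition has_exponent :: "('a, 'm) monoid_scheme \<Rightarrow> nat \<Rightarrow> bool" where
  "has_exponent G n \<longleftrightarrow> n > 0 \<and> (\<forall>x\<in>carrier G. x [^]\<^bsub>G\<^esub> n = \<one>\<^bsub>G\<^esub>) \<and>
     (\<forall>m>0. (\<forall>x\<in>carrier G. x [^]\<^bsub>G\<^esub> m = \<one>\<^bsub>G\<^esub>) \<longrightarrow> n \<le> m)"

section \<open>Varieties of groups\<close>

text \<open>A word in countably many variables is a list of letters; \<open>(i, True)\<close> stands for the
  variable with index \<open>i\<close> and \<open>(i, False)\<close> for its inverse. Words need not be reduced. A word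
  \<open>w\<close> is read as the law \<open>w = 1\<close>.\<close>

type_synonym word = "(nat \<times> bool) list"

definition eval_word :: "('a, 'm) monoid_scheme \<Rightarrow> (nat \<Rightarrow> 'a) \<Rightarrow> word \<Rightarrow> 'a" where
  "eval_word G s w =
     foldr (\<lambda>(i, pos) r. (if pos then s i else inv\<^bsub>G\<^esub> (s i)) \<otimes>\<^bsub>G\<^esub> r) w \<one>\<^bsub>G\<^esub>"

definition satisfies :: "('a, 'm) monoid_scheme \<Rightarrow> word set \<Rightarrow> bool" where
  "satisfies G L \<longleftrightarrow> (\<forall>w\<in>L. \<forall>s \<in> UNIV \<rightarrow> carrier G. eval_word G s w = \<one>\<^bsub>G\<^esub>)"

text \<open>A class of groups is rendered as the set of its members whose elements are taken from a
  given type. The definitions below are polymorphic in that type, so that the same variety can be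
  considered over several types at once.\<close>

definition variety :: "word set \<Rightarrow> 'g monoid set" where
  "variety L = {G. group G \<and> satisfies G L}"

text \<open>The smallest variety containing \<open>X\<close>. The type of \<open>X\<close> and that of the members of the
  variety are independent.\<close>

definition var_gen :: "('a, 'm) monoid_scheme \<Rightarrow> 'g monoid set" where
  "var_gen X = (\<Inter>L \<in> {L. satisfies X L}. variety L)"

definition abelian_variety :: "nat \<Rightarrow> 'g monoid set" where
  "abelian_variety n = {G. comm_group G \<and> (\<forall>x\<in>carrier G. x [^]\<^bsub>G\<^esub> n = \<one>\<^bsub>G\<^esub>)}"

text \<open>The second factor lives over \<open>'g set\<close> because the elements of \<open>G Mod N\<close> are cosets.\<close>

definition product_variety :: "'g monoid set \<Rightarrow> 'g set monoid set \<Rightarrow> 'g monoid set" where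
  "product_variety U V =
     {G. group G \<and> (\<exists>N. N \<lhd> G \<and> G\<lparr>carrier := N\<rparr> \<in> U \<and> G Mod N \<in> V)}"

section \<open>Wreath products\<close>

definition semidirect_product ::
    "('n, 'm1) monoid_scheme \<Rightarrow> ('h, 'm2) monoid_scheme \<Rightarrow> ('h \<Rightarrow> 'n \<Rightarrow> 'n) \<Rightarrow> ('n \<times> 'h) monoid" where
  "semidirect_product N H act =
     \<lparr>carrier = carrier N \<times> carrier H,
      monoid.mult = (\<lambda>(n, h) (n', h'). (n \<otimes>\<^bsub>N\<^esub> act h n', h \<otimes>\<^bsub>H\<^esub> h')),
      one = (\<one>\<^bsub>N\<^esub>, \<one>\<^bsub>H\<^esub>)\<rparr>"

text \<open>Left action of \<open>B\<close> on functions on \<open>B\<close>.\<close>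

definition shift :: "('b, 'm) monoid_scheme \<Rightarrow> 'b \<Rightarrow> ('b \<Rightarrow> 'a) \<Rightarrow> ('b \<Rightarrow> 'a)" where
  "shift B b f = (\<lambda>x\<in>carrier B. f (x \<otimes>\<^bsub>B\<^esub> b))"

definition wreath_product ::
    "('a, 'm1) monoid_scheme \<Rightarrow> ('b, 'm2) monoid_scheme \<Rightarrow> (('b \<Rightarrow> 'a) \<times> 'b) monoid"
    (infixr \<open>Wr\<close> 75) where
  "A Wr B = semidirect_product (product_group (carrier B) (\<lambda>_. A)) B (shift B)"

lemma group_semidirect_product:
  assumes "group N" "group H"
    and closed: "\<And>h n. h \<in> carrier H \<Longrightarrow> n \<in> carrier N \<Longrightarrow> act h n \<in> carrier N"
    and hom: "\<And>h n n'. h \<in> carrier H \<Longrightarrow> n \<in> carrier N \<Longrightarrow> n' \<in> carrier N \<Longrightarrow>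
                act h (n \<otimes>\<^bsub>N\<^esub> n') = act h n \<otimes>\<^bsub>N\<^esub> act h n'"
    and one: "\<And>n. n \<in> carrier N \<Longrightarrow> act \<one>\<^bsub>H\<^esub> n = n"
    and comp: "\<And>h h' n. h \<in> carrier H \<Longrightarrow> h' \<in> carrier H \<Longrightarrow> n \<in> carrier N \<Longrightarrow>
                act (h \<otimes>\<^bsub>H\<^esub> h') n = act h (act h' n)"
  shows "group (semidirect_product N H act)"
proof -
  interpret N: group N by fact
  interpret H: group H by fact
  show ?thesis
  proof (rule groupI)
    fix x assume "x \<in> carrier (semidirect_product N H act)"
    then obtain n h where x: "x = (n, h)" "n \<in> carrier N" "h \<in> carrier H"
      by (auto simp: semidirect_product_def)
    let ?y = "(act (inv\<^bsub>H\<^esub> h) (inv\<^bsub>N\<^esub> n), inv\<^bsub>H\<^esub> h)"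
    have eq: "act (inv\<^bsub>H\<^esub> h) (inv\<^bsub>N\<^esub> n) \<otimes>\<^bsub>N\<^esub> act (inv\<^bsub>H\<^esub> h) n = act (inv\<^bsub>H\<^esub> h) \<one>\<^bsub>N\<^esub>"
      using x by (simp flip: hom)
    have "act (inv\<^bsub>H\<^esub> h) \<one>\<^bsub>N\<^esub> \<otimes>\<^bsub>N\<^esub> act (inv\<^bsub>H\<^esub> h) \<one>\<^bsub>N\<^esub> = act (inv\<^bsub>H\<^esub> h) \<one>\<^bsub>N\<^esub>"
      using x by (simp flip: hom)
    then have "act (inv\<^bsub>H\<^esub> h) \<one>\<^bsub>N\<^esub> = \<one>\<^bsub>N\<^esub>"
      using x closed[of "inv\<^bsub>H\<^esub> h" "\<one>\<^bsub>N\<^esub>"] by (simp add: N.l_cancel_one)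
    with eq x show "\<exists>y\<in>carrier (semidirect_product N H act).
        y \<otimes>\<^bsub>semidirect_product N H act\<^esub> x = \<one>\<^bsub>semidirect_product N H act\<^esub>"
      by (intro bexI[of _ ?y]) (auto simp: semidirect_product_def closed)
  qed (auto simp: semidirect_product_def closed hom one comp N.m_assoc H.m_assoc)
qed

lemma group_wreath_product:
  assumes "group A" "group B"
  shows "group (A Wr B)"
proof -
  interpret A: group A by fact
  interpret B: group B by fact
  show ?thesis
    unfolding wreath_product_def
    by (rule group_semidirect_product)
       (auto simp: assms shift_def PiE_iff B.m_assoc extensional_def fun_eq_iff)
qed

end

theory Submission
  imports Defs "HOL-Library.Countable_Set" "HOL-Algebra.Free_Abelian_Groups"
    "HOL-Algebra.Multiplicative_Group"
begin

text \<open>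
  Varieties are compared through their laws. A group lies in the product of the varieties of
  \<open>A\<close> and \<open>B\<close> iff it satisfies every law that arises from a law of \<open>A\<close> by substituting laws of
  \<open>B\<close> for its variables (\<open>product_variety_eq_variety\<close>). The wreath product satisfies these laws,
  as its base group is a power of \<open>A\<close> with quotient \<open>B\<close>. So the only question is whether
  \<open>A Wr B\<close> satisfies further laws.

  Suppose that \<open>B\<close> contains the infinite sum of cyclic groups of order \<open>p ^ v\<close>. Then it contains
  elements \<open>b\<^sub>0, b\<^sub>1, \<dots>\<close> that satisfy no relation except the laws of \<open>B\<close>. Evaluate a word \<open>w\<close> at
  elements \<open>(f\<^sub>i, b\<^sub>i)\<close> of \<open>A Wr B\<close>. The coordinate at \<open>c\<close> of the value is the product of the labels
  along the path that \<open>w\<close> traces from \<open>c\<close> in the Cayley graph of the \<open>b\<^sub>i\<close>, where the edge from \<open>c\<close>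
  to \<open>c b\<^sub>i\<close> is labelled by \<open>f\<^sub>i c\<close>. Labels of different edges are independent of each other, so if
  \<open>w\<close> is a law of \<open>A Wr B\<close>, then its path is closed and the word in the edges that it spells is a
  law of \<open>A\<close>. In a group \<open>G\<close> with a normal subgroup \<open>N\<close> as in the product variety, the
  Reidemeister-Schreier rewriting of \<open>w\<close> along the same path expresses each value of \<open>w\<close>, up to
  conjugation, as a value of that edge word in \<open>N\<close>. Hence \<open>w\<close> is a law of \<open>G\<close>
  (\<open>wreath_law_in_product_variety\<close>, for arbitrary groups \<open>A\<close> and \<open>B\<close>).

  For the converse let \<open>q = p ^ (v - 1)\<close>. If the group \<open>D\<close> of all \<open>q\<close>-th powers in \<open>B\<close> is
  infinite, then \<open>q\<close>-th roots of a linearly independent sequence in the elementary abelian group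
  \<open>D\<close> generate the required sum (\<open>contains_cyclic_sum\<close>). If \<open>D\<close> is finite, \<open>A Wr B\<close> satisfies a
  law that fails in the product variety. The law says that a \<open>p ^ v\<close>-th power, which lies in
  the base group, is annihilated by a long composition of norms
  \<open>u \<mapsto> u (z u z\<^sup>-\<^sup>1) \<cdots> (z\<^sup>p\<^sup>-\<^sup>1 u z\<^sup>1\<^sup>-\<^sup>p)\<close> along \<open>q\<close>-th powers \<open>z\<close> of different variables. It holds in
  \<open>A Wr B\<close> because on a central factor of the base group a norm along \<open>z\<close> produces elements
  fixed by \<open>z\<close>, and among \<open>card D\<close> successive \<open>z\<close> one acts like the inverse of a product of
  earlier ones, so that its norm is only the \<open>p\<close>-th power map. A bounded number of such rounds kills each of
  the finitely many factors (\<open>norm_law_holds\<close>). It fails when the top group is the infinite sum,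
  because there the translates of a function supported at one point along independent
  directions never overlap (\<open>norm_law_fails\<close>). That wreath product satisfies the laws of the
  product variety, and a law can be tested on countable subgroups, so the norm law also fails in some group of the product variety whose elements are taken from the given
  infinite type (\<open>satisfies_if_on_infinite_type\<close>).
\<close>

section \<open>Words and their values\<close>

lemma eval_word_Nil [simp]: "eval_word G s [] = \<one>\<^bsub>G\<^esub>"
  by (simp add: eval_word_def)

lemma eval_word_Cons [simp]:
  "eval_word G s ((i, pos) # w) = (if pos then s i else inv\<^bsub>G\<^esub> (s i)) \<otimes>\<^bsub>G\<^esub> eval_word G s w"
  by (simp add: eval_word_def)

definition inv_word :: "word \<Rightarrow> word" where
  "inv_word w = rev (map (\<lambda>(i, pos). (i, \<not> pos)) w)"

definition power_word :: "word \<Rightarrow> nat \<Rightarrow> word" where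
  "power_word w n = concat (replicate n w)"

definition subst_word :: "(nat \<Rightarrow> word) \<Rightarrow> word \<Rightarrow> word" where
  "subst_word \<sigma> w = concat (map (\<lambda>(i, pos). if pos then \<sigma> i else inv_word (\<sigma> i)) w)"

abbreviation rename_word :: "(nat \<Rightarrow> nat) \<Rightarrow> word \<Rightarrow> word" where
  "rename_word f \<equiv> subst_word (\<lambda>i. [(f i, True)])"

context group
begin

lemma eval_word_closed [simp]:
  "s \<in> UNIV \<rightarrow> carrier G \<Longrightarrow> eval_word G s w \<in> carrier G"
  by (induction w) (auto simp: Pi_iff)

lemma eval_word_append:
  "s \<in> UNIV \<rightarrow> carrier G \<Longrightarrow> eval_word G s (u @ w) = eval_word G s u \<otimes> eval_word G s w"
  by (induction u) (auto simp: Pi_iff m_assoc)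

lemma eval_word_inv:
  assumes "s \<in> UNIV \<rightarrow> carrier G"
  shows "eval_word G s (inv_word w) = inv (eval_word G s w)"
proof (induction w)
  case (Cons a w)
  obtain i b where a: "a = (i, b)" by force
  have "eval_word G s (inv_word (a # w)) = eval_word G s (inv_word w) \<otimes> eval_word G s [(i, \<not> b)]"
    using assms by (simp add: inv_word_def a eval_word_append del: eval_word_Cons)
  then show ?case
    using assms Cons by (auto simp: a Pi_iff inv_mult_group)
qed (simp add: inv_word_def)

lemma eval_word_power:
  assumes "s \<in> UNIV \<rightarrow> carrier G"
  shows "eval_word G s (power_word w n) = eval_word G s w [^] n"
proof (induction n)
  case (Suc n)
  then show ?case
    using assms nat_pow_Suc2[of "eval_word G s w" n]
    by (simp add: power_word_def eval_word_append del: nat_pow_Suc)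
qed (simp add: power_word_def)

lemma eval_word_subst:
  assumes "s \<in> UNIV \<rightarrow> carrier G"
  shows "eval_word G s (subst_word \<sigma> w) = eval_word G (\<lambda>i. eval_word G s (\<sigma> i)) w"
  using assms
  by (induction w) (auto simp: subst_word_def eval_word_append eval_word_inv)

lemma eval_word_rename:
  assumes "s \<in> UNIV \<rightarrow> carrier G"
  shows "eval_word G s (rename_word f w) = eval_word G (\<lambda>i. s (f i)) w"
proof -
  have "(\<lambda>i. eval_word G s [(f i, True)]) = (\<lambda>i. s (f i))"
    using assms by (auto simp: Pi_iff)
  then show ?thesis using assms by (simp add: eval_word_subst del: eval_word_Cons)
qed

lemma eval_word_subgroup:
  assumes "subgroup N G" "s \<in> UNIV \<rightarrow> N"
  shows "eval_word (G\<lparr>carrier := N\<rparr>) s w = eval_word G s w"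
proof -
  have "inv\<^bsub>G\<lparr>carrier := N\<rparr>\<^esub> (s i) = inv (s i)" for i
    using assms by (intro m_inv_consistent) auto
  then show ?thesis by (induction w) auto
qed

lemma subgroup_word_values:
  assumes "s \<in> UNIV \<rightarrow> carrier G"
  shows "subgroup (range (eval_word G s)) G"
proof
  show "\<one> \<in> range (eval_word G s)" by (metis eval_word_Nil rangeI)
qed (use assms in \<open>auto simp flip: eval_word_append eval_word_inv\<close>)

end

lemma (in group_hom) eval_word_hom:
  assumes "s \<in> UNIV \<rightarrow> carrier G"
  shows "h (eval_word G s w) = eval_word H (\<lambda>i. h (s i)) w"
  using assms by (induction w) (auto simp: Pi_iff)

section \<open>Varieties through their laws\<close>

lemma satisfies_singleton:
  "satisfies G {w} \<longleftrightarrow> (\<forall>s \<in> UNIV \<rightarrow> carrier G. eval_word G s w = \<one>\<^bsub>G\<^esub>)"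
  by (simp add: satisfies_def)

lemma satisfies_iff_singletons: "satisfies G L \<longleftrightarrow> (\<forall>w\<in>L. satisfies G {w})"
  by (simp add: satisfies_def)

lemma var_gen_iff:
  "G \<in> var_gen X \<longleftrightarrow> group G \<and> (\<forall>w. satisfies X {w} \<longrightarrow> satisfies G {w})"
proof -
  have "G \<in> var_gen X \<longleftrightarrow> (\<forall>L. satisfies X L \<longrightarrow> group G \<and> satisfies G L)"
    by (auto simp: var_gen_def variety_def)
  also have "\<dots> \<longleftrightarrow> group G \<and> (\<forall>w. satisfies X {w} \<longrightarrow> satisfies G {w})"
    by (metis satisfies_iff_singletons empty_iff)
  finally show ?thesis .
qed

definition product_laws :: "('a, 'm) monoid_scheme \<Rightarrow> ('b, 'n) monoid_scheme \<Rightarrow> word set" where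
  "product_laws A B =
     {subst_word \<sigma> w | \<sigma> w. satisfies A {w} \<and> (\<forall>i. satisfies B {\<sigma> i})}"

lemma satisfies_rename:
  assumes "group B" "satisfies B {w}"
  shows "satisfies B {rename_word f w}"
  using assms by (auto simp: satisfies_singleton group.eval_word_rename Pi_iff)

lemma (in normal) eval_word_in_normal:
  assumes "s \<in> UNIV \<rightarrow> carrier G" "satisfies (G Mod H) {w}"
  shows "eval_word G s w \<in> H"
proof -
  interpret h: group_hom G "G Mod H" "\<lambda>a. H #> a"
    using r_coset_hom_Mod factorgroup_is_group
    by (simp add: group_hom_def group_hom_axioms_def is_group)
  have "H #> eval_word G s w = H"
    using assms by (simp add: h.eval_word_hom satisfies_singleton Pi_iff)
  then show ?thesis
    using assms(1) rcos_self by (metis eval_word_closed subgroup_axioms)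
qed

text \<open>A law of \<open>B\<close> holds in the quotient, so its values lie in \<open>N\<close>, where the law of \<open>A\<close> applies.\<close>

lemma extension_satisfies_product_laws:
  fixes G :: "('g, 'm) monoid_scheme"
  assumes "group G" "N \<lhd> G"
    and N: "\<And>w. satisfies A {w} \<Longrightarrow> satisfies (G\<lparr>carrier := N\<rparr>) {w}"
    and Q: "\<And>w. satisfies B {w} \<Longrightarrow> satisfies (G Mod N) {w}"
  shows "satisfies G (product_laws A B)"
  unfolding satisfies_def
proof (intro ballI)
  fix u and s :: "nat \<Rightarrow> 'g"
  assume "u \<in> product_laws A B" and s: "s \<in> UNIV \<rightarrow> carrier G"
  then obtain \<sigma> w where u: "u = subst_word \<sigma> w" and w: "satisfies A {w}"
    and \<sigma>: "\<And>i. satisfies B {\<sigma> i}"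
    by (auto simp: product_laws_def)
  interpret N: normal N G by fact
  have "eval_word G s (\<sigma> i) \<in> N" for i
    using N.eval_word_in_normal s Q[OF \<sigma>] by blast
  then have "eval_word G (\<lambda>i. eval_word G s (\<sigma> i)) w = \<one>\<^bsub>G\<^esub>"
    using bspec[OF N[OF w, unfolded satisfies_singleton], of "\<lambda>i. eval_word G s (\<sigma> i)"]
      N.eval_word_subgroup[OF N.subgroup_axioms, of "\<lambda>i. eval_word G s (\<sigma> i)" w]
    by simp
  then show "eval_word G s u = \<one>\<^bsub>G\<^esub>" using s by (simp add: u N.eval_word_subst)
qed

text \<open>The normal subgroup is the verbal subgroup of the laws of \<open>B\<close>. All products of values
  of laws are themselves values of laws, because the variables of the factors can be made
  disjoint; this is what the pairing function is for.\<close>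

lemma extension_if_satisfies_product_laws:
  assumes "group G" "group B" and G: "satisfies G (product_laws A B)"
  obtains N where "N \<lhd> G"
    and "\<And>w. satisfies A {w} \<Longrightarrow> satisfies (G\<lparr>carrier := N\<rparr>) {w}"
    and "\<And>w. satisfies B {w} \<Longrightarrow> satisfies (G Mod N) {w}"
proof
  define N where "N = {eval_word G s u | s u. s \<in> UNIV \<rightarrow> carrier G \<and> satisfies B {u}}"
  interpret G: group G by fact
  interpret B: group B by fact
  \<comment> \<open>One assignment of the variables can serve countably many elements of \<open>N\<close> at the same time.\<close>
  have joint: "\<exists>s \<in> UNIV \<rightarrow> carrier G. \<exists>\<sigma>. \<forall>i. satisfies B {\<sigma> i} \<and> eval_word G s (\<sigma> i) = x i"
    if x: "x \<in> UNIV \<rightarrow> N" for x :: "nat \<Rightarrow> _"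
  proof -
    have "\<forall>i. \<exists>(s :: nat \<Rightarrow> _) u. s \<in> UNIV \<rightarrow> carrier G \<and> satisfies B {u} \<and> x i = eval_word G s u"
    proof
      fix i
      have "x i \<in> N" using x by auto
      then show "\<exists>(s :: nat \<Rightarrow> _) u. s \<in> UNIV \<rightarrow> carrier G \<and> satisfies B {u} \<and> x i = eval_word G s u"
        unfolding N_def by blast
    qed
    then obtain s u where su: "\<And>i. s i \<in> UNIV \<rightarrow> carrier G" "\<And>i. satisfies B {u i}"
      "\<And>i. x i = eval_word G (s i) (u i)"
      by metis
    define t where "t = (\<lambda>k. case prod_decode k of (i, j) \<Rightarrow> s i j)"
    have t: "t \<in> UNIV \<rightarrow> carrier G" using su(1) by (auto simp: t_def Pi_iff split: prod.split)
    have "satisfies B {rename_word (\<lambda>j. prod_encode (i, j)) (u i)}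
        \<and> eval_word G t (rename_word (\<lambda>j. prod_encode (i, j)) (u i)) = x i" for i
      using su t by (simp add: satisfies_rename B.is_group G.eval_word_rename) (simp add: t_def)
    with t show ?thesis by (intro bexI[of _ t] exI[of _ "\<lambda>i. rename_word (\<lambda>j. prod_encode (i, j)) (u i)"]) auto
  qed
  have sub: "subgroup N G"
  proof
    show "N \<subseteq> carrier G" by (auto simp: N_def)
    show "\<one>\<^bsub>G\<^esub> \<in> N"
      unfolding N_def by (rule CollectI, rule exI[of _ "\<lambda>_. \<one>\<^bsub>G\<^esub>"], rule exI[of _ "[]"])
        (auto simp: satisfies_singleton)
  next
    fix x assume "x \<in> N"
    then obtain s u where su: "s \<in> UNIV \<rightarrow> carrier G" "satisfies B {u}" "x = eval_word G s u"
      by (auto simp: N_def)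
    then have "satisfies B {inv_word u}" "inv\<^bsub>G\<^esub> x = eval_word G s (inv_word u)"
      by (auto simp: satisfies_singleton B.eval_word_inv G.eval_word_inv)
    then show "inv\<^bsub>G\<^esub> x \<in> N" using su by (auto simp: N_def)
  next
    fix x y assume "x \<in> N" "y \<in> N"
    then obtain s \<sigma> where s: "s \<in> UNIV \<rightarrow> carrier G"
      and \<sigma>: "\<And>i::nat. satisfies B {\<sigma> i} \<and> eval_word G s (\<sigma> i) = (if i = 0 then x else y)"
      using joint[of "\<lambda>i. if i = 0 then x else y"] by auto
    from \<sigma>[of 0] \<sigma>[of 1] have "satisfies B {\<sigma> 0 @ \<sigma> 1}" "x \<otimes>\<^bsub>G\<^esub> y = eval_word G s (\<sigma> 0 @ \<sigma> 1)"
      using s by (auto simp: satisfies_singleton B.eval_word_append G.eval_word_append)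
    then show "x \<otimes>\<^bsub>G\<^esub> y \<in> N" using s by (auto simp: N_def)
  qed
  show "N \<lhd> G"
  proof (rule G.normal_invI[OF sub])
    fix g x assume g: "g \<in> carrier G" and "x \<in> N"
    then obtain s u where su: "s \<in> UNIV \<rightarrow> carrier G" "satisfies B {u}" "x = eval_word G s u"
      by (auto simp: N_def)
    define h where "h = (\<lambda>x. g \<otimes>\<^bsub>G\<^esub> x \<otimes>\<^bsub>G\<^esub> inv\<^bsub>G\<^esub> g)"
    have "h (a \<otimes>\<^bsub>G\<^esub> b) = h a \<otimes>\<^bsub>G\<^esub> h b" if ab: "a \<in> carrier G" "b \<in> carrier G" for a b
    proof -
      have "inv\<^bsub>G\<^esub> g \<otimes>\<^bsub>G\<^esub> (g \<otimes>\<^bsub>G\<^esub> y) = y" if "y \<in> carrier G" for y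
        using g that by (simp flip: G.m_assoc)
      then show ?thesis using g ab by (simp add: h_def G.m_assoc)
    qed
    then interpret h: group_hom G G h
      using g by unfold_locales (auto simp: hom_def h_def)
    have "g \<otimes>\<^bsub>G\<^esub> x \<otimes>\<^bsub>G\<^esub> inv\<^bsub>G\<^esub> g = eval_word G (\<lambda>i. h (s i)) u"
      using su h.eval_word_hom[of s u] by (simp add: h_def)
    moreover have "(\<lambda>i. h (s i)) \<in> UNIV \<rightarrow> carrier G" using su by (auto simp: Pi_iff)
    ultimately show "g \<otimes>\<^bsub>G\<^esub> x \<otimes>\<^bsub>G\<^esub> inv\<^bsub>G\<^esub> g \<in> N"
      using su unfolding N_def by blast
  qed
  then interpret N: normal N G .
  interpret h: group_hom G "G Mod N" "\<lambda>a. N #>\<^bsub>G\<^esub> a"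
    using N.r_coset_hom_Mod N.factorgroup_is_group
    by (simp add: group_hom_def group_hom_axioms_def assms(1))
  fix w
  {
    assume w: "satisfies A {w}"
    show "satisfies (G\<lparr>carrier := N\<rparr>) {w}"
      unfolding satisfies_singleton
    proof
      fix x :: "nat \<Rightarrow> _" assume x: "x \<in> UNIV \<rightarrow> carrier (G\<lparr>carrier := N\<rparr>)"
      then have "x \<in> UNIV \<rightarrow> N" by simp
      from joint[OF this] obtain s \<sigma> where s: "s \<in> UNIV \<rightarrow> carrier G"
        and \<sigma>: "\<And>i::nat. satisfies B {\<sigma> i}" "\<And>i. eval_word G s (\<sigma> i) = x i"
        by blast
      have "subst_word \<sigma> w \<in> product_laws A B" using \<sigma> w by (auto simp: product_laws_def)
      then have "eval_word G s (subst_word \<sigma> w) = \<one>\<^bsub>G\<^esub>" using G s by (auto simp: satisfies_def)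
      then show "eval_word (G\<lparr>carrier := N\<rparr>) x w = \<one>\<^bsub>G\<lparr>carrier := N\<rparr>\<^esub>"
        using x s by (simp add: G.eval_word_subst \<sigma>(2) G.eval_word_subgroup[OF sub])
    qed
  }
  {
    assume w: "satisfies B {w}"
    show "satisfies (G Mod N) {w}"
      unfolding satisfies_singleton
    proof
      fix x :: "nat \<Rightarrow> _" assume "x \<in> UNIV \<rightarrow> carrier (G Mod N)"
      then have "\<forall>i. \<exists>a. a \<in> carrier G \<and> x i = N #>\<^bsub>G\<^esub> a" by (auto simp: carrier_FactGroup Pi_iff)
      then obtain a where a: "\<And>i. a i \<in> carrier G" "\<And>i. x i = N #>\<^bsub>G\<^esub> a i" by metis
      then have "x = (\<lambda>i. N #>\<^bsub>G\<^esub> a i)" by auto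
      then have "eval_word (G Mod N) x w = N #>\<^bsub>G\<^esub> eval_word G a w"
        using h.eval_word_hom[of a w] a(1) by auto
      moreover have "a \<in> UNIV \<rightarrow> carrier G" using a(1) by blast
      then have "eval_word G a w \<in> N" using w unfolding N_def by blast
      ultimately show "eval_word (G Mod N) x w = \<one>\<^bsub>G Mod N\<^esub>"
        using N.rcos_const by simp
    qed
  }
qed

text \<open>The right-hand side does not depend on the type of the group elements, while the quotient groups
  on the left live over a type of cosets. This is what makes it possible to leave the given type.\<close>

lemma product_variety_eq_variety:
  assumes "group B"
  shows "product_variety (var_gen A) (var_gen B) = variety (product_laws A B)"
proof (rule subset_antisym; rule subsetI)
  fix G assume "G \<in> product_variety (var_gen A) (var_gen B)"
  then show "G \<in> variety (product_laws A B)"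
    by (auto simp: product_variety_def variety_def var_gen_iff intro: extension_satisfies_product_laws)
next
  fix G assume "G \<in> variety (product_laws A B)"
  then have G: "group G" "satisfies G (product_laws A B)" by (auto simp: variety_def)
  from extension_if_satisfies_product_laws[OF G(1) assms G(2)] obtain N where N: "N \<lhd> G"
    "\<And>w. satisfies A {w} \<Longrightarrow> satisfies (G\<lparr>carrier := N\<rparr>) {w}"
    "\<And>w. satisfies B {w} \<Longrightarrow> satisfies (G Mod N) {w}"
    by blast
  then have "group (G\<lparr>carrier := N\<rparr>)" "group (G Mod N)"
    using G(1) by (auto simp: normal.factorgroup_is_group normal_imp_subgroup subgroup.subgroup_is_group)
  with N G show "G \<in> product_variety (var_gen A) (var_gen B)"
    by (auto simp: product_variety_def var_gen_iff)
qed

text \<open>A law involves one tuple at a time, and the subgroup generated by a sequence is countable,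
  so it has a copy on any infinite type.\<close>

lemma satisfies_if_on_infinite_type:
  fixes G :: "('g, 'm) monoid_scheme"
  assumes inf: "infinite (UNIV :: 'u set)"
    and "group G" "satisfies G L"
    and small: "\<And>H :: 'u monoid. group H \<Longrightarrow> satisfies H L \<Longrightarrow> satisfies H {w}"
  shows "satisfies G {w}"
  unfolding satisfies_singleton
proof
  fix s :: "nat \<Rightarrow> 'g" assume s: "s \<in> UNIV \<rightarrow> carrier G"
  interpret G: group G by fact
  define S where "S = range (eval_word G s)"
  have sub: "subgroup S G" unfolding S_def by (rule G.subgroup_word_values[OF s])
  interpret GS: group "G\<lparr>carrier := S\<rparr>" using sub assms(2) by (simp add: subgroup.subgroup_is_group)
  have "countable S" by (simp add: S_def)
  obtain e :: "nat \<Rightarrow> 'u" where e: "inj e" using infinite_countable_subset[OF inf] by blast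
  define f where "f = e \<circ> to_nat_on S"
  have f: "inj_on f S" unfolding f_def using \<open>countable S\<close> e
    by (intro comp_inj_on) (auto intro: inj_on_subset)
  define g where "g = inv_into S f"
  have gf [simp]: "g (f x) = x" if "x \<in> S" for x using f that by (simp add: g_def)
  define H :: "'u monoid" where
    "H = \<lparr>carrier = f ` S, monoid.mult = (\<lambda>x y. f (g x \<otimes>\<^bsub>G\<^esub> g y)), one = f \<one>\<^bsub>G\<^esub>\<rparr>"
  have f_iso: "f \<in> iso (G\<lparr>carrier := S\<rparr>) H"
    using f by (auto simp: iso_def hom_def H_def bij_betw_def)
  have H: "group H" using GS.iso_imp_img_group[OF f_iso] by (simp add: H_def)
  have "g \<in> hom H G"
    using sub by (auto simp: hom_def H_def subgroup.m_closed subgroup.mem_carrier)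
  then interpret g: group_hom H G g
    using H by (simp add: group_hom_def group_hom_axioms_def assms(2))
  interpret f: group_hom "G\<lparr>carrier := S\<rparr>" H f
    using H f_iso GS.is_group by (simp add: group_hom_def group_hom_axioms_def iso_def)
  have g_inj: "x = \<one>\<^bsub>H\<^esub>" if "x \<in> carrier H" "g x = \<one>\<^bsub>G\<^esub>" for x
    using that sub by (auto simp: H_def)
  have "satisfies H L"
    using assms(3) by (auto simp: satisfies_def Pi_iff g.eval_word_hom intro!: g_inj)
  then have w: "satisfies H {w}" using H small by blast
  have sS: "s \<in> UNIV \<rightarrow> S"
  proof
    fix i show "s i \<in> S" unfolding S_def using s
      by (intro range_eqI[of _ _ "[(i, True)]"]) (auto simp: Pi_iff)
  qed
  then have "f (eval_word G s w) = \<one>\<^bsub>H\<^esub>"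
    using w f.eval_word_hom[of s w] G.eval_word_subgroup[OF sub sS]
    by (auto simp: satisfies_singleton Pi_iff)
  then show "eval_word G s w = \<one>\<^bsub>G\<^esub>"
    using f sub by (metis H_def S_def gf monoid.select_convs(2) rangeI subgroup.one_closed)
qed

section \<open>Wreath products\<close>

lemma carrier_wreath:
  "carrier (A Wr B) = (carrier B \<rightarrow>\<^sub>E carrier A) \<times> carrier B"
  by (simp add: wreath_product_def semidirect_product_def)

lemma mult_wreath [simp]:
  "(f, b) \<otimes>\<^bsub>A Wr B\<^esub> (g, c) = ((\<lambda>x\<in>carrier B. f x \<otimes>\<^bsub>A\<^esub> g (x \<otimes>\<^bsub>B\<^esub> b)), b \<otimes>\<^bsub>B\<^esub> c)"
  by (simp add: wreath_product_def semidirect_product_def shift_def cong: restrict_cong)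

lemma one_wreath: "\<one>\<^bsub>A Wr B\<^esub> = ((\<lambda>x\<in>carrier B. \<one>\<^bsub>A\<^esub>), \<one>\<^bsub>B\<^esub>)"
  by (simp add: wreath_product_def semidirect_product_def)

lemma inv_wreath:
  assumes "group A" "group B" "(f, b) \<in> carrier (A Wr B)"
  shows "inv\<^bsub>A Wr B\<^esub> (f, b) =
    ((\<lambda>x\<in>carrier B. inv\<^bsub>A\<^esub> (f (x \<otimes>\<^bsub>B\<^esub> inv\<^bsub>B\<^esub> b))), inv\<^bsub>B\<^esub> b)"
proof -
  interpret A: group A by fact
  interpret B: group B by fact
  interpret W: group "A Wr B" by (rule group_wreath_product) fact+
  show ?thesis
    by (rule W.inv_equality) (use assms in \<open>auto simp: one_wreath carrier_wreath PiE_iff B.m_assoc cong: restrict_cong\<close>)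
qed

section \<open>Wreath products whose top group contains a relatively free group\<close>

text \<open>The path that a word traces from \<open>c\<close> in the Cayley graph of the sequence \<open>b\<close> runs through
  vertices \<open>c\<close> and edges \<open>(c, i)\<close> from \<open>c\<close> to \<open>c \<otimes> b i\<close>. Edges have to become variables, which are
  natural numbers, although \<open>B\<close> may be uncountable. As only vertices in the subgroup generated by
  \<open>b\<close> are visited, a vertex can be encoded by a word with that value. Such a word also serves as
  the representative of the vertex in any group with a corresponding sequence \<open>g\<close>.\<close>

definition word_for :: "('b, 'm) monoid_scheme \<Rightarrow> (nat \<Rightarrow> 'b) \<Rightarrow> 'b \<Rightarrow> word" where
  "word_for B b c = (SOME u. eval_word B b u = c)"

lemma eval_word_for:
  "c \<in> range (eval_word B b) \<Longrightarrow> eval_word B b (word_for B b c) = c"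
  unfolding word_for_def by (rule someI_ex) auto

definition edge :: "('b, 'm) monoid_scheme \<Rightarrow> (nat \<Rightarrow> 'b) \<Rightarrow> 'b \<Rightarrow> nat \<Rightarrow> nat" where
  "edge B b c i = to_nat (word_for B b c, i)"

fun trace_word :: "('b, 'm) monoid_scheme \<Rightarrow> (nat \<Rightarrow> 'b) \<Rightarrow> 'b \<Rightarrow> word \<Rightarrow> word" where
  "trace_word B b c [] = []"
| "trace_word B b c ((i, True) # w) = (edge B b c i, True) # trace_word B b (c \<otimes>\<^bsub>B\<^esub> b i) w"
| "trace_word B b c ((i, False) # w) =
     (edge B b (c \<otimes>\<^bsub>B\<^esub> inv\<^bsub>B\<^esub> b i) i, False) # trace_word B b (c \<otimes>\<^bsub>B\<^esub> inv\<^bsub>B\<^esub> b i) w"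

text \<open>The coordinate at \<open>c\<close> collects one factor for each letter, namely the label of the edge that the
  letter crosses: a letter shifts the coordinates of all that follows it by its component in \<open>B\<close>.
  The assignment labels each edge by the value of the variable that encodes it.\<close>

lemma eval_word_wreath:
  fixes \<sigma> :: "nat \<Rightarrow> 'a"
  assumes "group A" "group B" and b: "b \<in> UNIV \<rightarrow> carrier B" and \<sigma>: "\<sigma> \<in> UNIV \<rightarrow> carrier A"
  shows "eval_word (A Wr B) (\<lambda>i. (\<lambda>c\<in>carrier B. \<sigma> (edge B b c i), b i)) w =
    ((\<lambda>c\<in>carrier B. eval_word A \<sigma> (trace_word B b c w)), eval_word B b w)"
proof (induction w)
  case Nil
  then show ?case by (auto simp: one_wreath)
next
  case (Cons l w)
  interpret B: group B by fact
  obtain i pos where l: "l = (i, pos)" by force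
  have "(\<lambda>c\<in>carrier B. \<sigma> (edge B b c i), b i) \<in> carrier (A Wr B)"
    using b \<sigma> by (auto simp: carrier_wreath Pi_iff)
  note inv = inv_wreath[OF assms(1,2) this]
  show ?case
    using b by (cases pos) (auto simp: l Cons inv Pi_iff simp del: restrict_apply simp: restrict_apply' cong: restrict_cong)
qed

text \<open>Here \<open>t c\<close> represents the vertex \<open>c\<close> in \<open>G\<close>, and \<open>\<sigma>\<close> labels the edge \<open>(c, i)\<close> by
  \<open>t c \<otimes> g i \<otimes> inv (t (c \<otimes> b i))\<close>. Along a path the inner representatives cancel, which leaves those of
  the two ends.\<close>

lemma eval_trace_word:
  fixes g :: "nat \<Rightarrow> 'g" and b :: "nat \<Rightarrow> 'b"
  assumes "group G" "group B" and g: "g \<in> UNIV \<rightarrow> carrier G" and b: "b \<in> UNIV \<rightarrow> carrier B"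
    and t_def: "\<And>c. t c = eval_word G g (word_for B b c)"
    and \<sigma>_def: "\<And>k. \<sigma> k = (case from_nat k of (u, i) \<Rightarrow>
      eval_word G g u \<otimes>\<^bsub>G\<^esub> g i \<otimes>\<^bsub>G\<^esub> inv\<^bsub>G\<^esub> (t (eval_word B b u \<otimes>\<^bsub>B\<^esub> b i)))"
    and c: "c \<in> range (eval_word B b)"
  shows "eval_word G \<sigma> (trace_word B b c w) =
    t c \<otimes>\<^bsub>G\<^esub> eval_word G g w \<otimes>\<^bsub>G\<^esub> inv\<^bsub>G\<^esub> (t (c \<otimes>\<^bsub>B\<^esub> eval_word B b w))"
  using c
proof (induction w arbitrary: c)
  case Nil
  interpret G: group G by fact
  interpret B: group B by fact
  show ?case using Nil g b by (auto simp: t_def)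
next
  case (Cons l w)
  interpret G: group G by fact
  interpret B: group B by fact
  obtain i pos where l: "l = (i, pos)" by force
  have t [simp]: "t c \<in> carrier G" for c using g by (simp add: t_def)
  have gi [simp]: "g i \<in> carrier G" for i using g by auto
  have bi [simp]: "b i \<in> carrier B" for i using b by auto
  have [simp]: "eval_word G g w \<in> carrier G" "eval_word B b w \<in> carrier B" for w using g b by auto
  have c: "c \<in> carrier B" using Cons.prems b by auto
  interpret S: subgroup "range (eval_word B b)" B
    using b by (rule B.subgroup_word_values)
  have bS: "b i \<in> range (eval_word B b)"
    using B.r_one[of "b i"] by (intro range_eqI[of _ _ "[(i, True)]"]) simp
  have \<sigma>: "\<sigma> (edge B b d i) = t d \<otimes>\<^bsub>G\<^esub> g i \<otimes>\<^bsub>G\<^esub> inv\<^bsub>G\<^esub> (t (d \<otimes>\<^bsub>B\<^esub> b i))"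
    if "d \<in> range (eval_word B b)" for d
    using that by (simp add: \<sigma>_def edge_def eval_word_for) (simp add: t_def)
  have cancel: "inv\<^bsub>G\<^esub> x \<otimes>\<^bsub>G\<^esub> (x \<otimes>\<^bsub>G\<^esub> y) = y" if "x \<in> carrier G" "y \<in> carrier G" for x y
    using that by (simp flip: G.m_assoc)
  show ?case
  proof (cases pos)
    case True
    have "c \<otimes>\<^bsub>B\<^esub> b i \<in> range (eval_word B b)" using Cons.prems bS by simp
    then show ?thesis
      using Cons.IH[of "c \<otimes>\<^bsub>B\<^esub> b i"] Cons.prems c
      by (simp add: l True \<sigma> G.m_assoc B.m_assoc cancel)
  next
    case False
    have d: "c \<otimes>\<^bsub>B\<^esub> inv\<^bsub>B\<^esub> b i \<in> range (eval_word B b)" using Cons.prems bS by simp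
    have "c \<otimes>\<^bsub>B\<^esub> inv\<^bsub>B\<^esub> b i \<otimes>\<^bsub>B\<^esub> b i = c" using c by (simp add: B.m_assoc)
    then have "inv\<^bsub>G\<^esub> (\<sigma> (edge B b (c \<otimes>\<^bsub>B\<^esub> inv\<^bsub>B\<^esub> b i) i))
        = t c \<otimes>\<^bsub>G\<^esub> (inv\<^bsub>G\<^esub> g i \<otimes>\<^bsub>G\<^esub> inv\<^bsub>G\<^esub> (t (c \<otimes>\<^bsub>B\<^esub> inv\<^bsub>B\<^esub> b i)))"
      using \<sigma>[OF d] by (simp add: G.inv_mult_group G.m_assoc)
    then show ?thesis
      using Cons.IH[OF d] d c
      by (simp add: l False G.m_assoc B.m_assoc cancel)
  qed
qed

text \<open>The hypothesis on \<open>b\<close> says that \<open>b\<close> freely generates a relatively free group in the variety of \<open>B\<close>.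
  Each label \<open>\<sigma>\<close> is the value in \<open>G\<close> of a word for a closed path in the Cayley graph. Such a word is
  trivial at \<open>b\<close>, hence a law of \<open>B\<close>, and so the labels lie in \<open>N\<close>, where the edge word of \<open>w\<close> holds as
  a law.\<close>

lemma wreath_law_in_product_variety:
  fixes G :: "('g, 'm) monoid_scheme" and A :: "('a, 'm1) monoid_scheme"
    and B :: "('b, 'm2) monoid_scheme"
  assumes "group A" "group B" "group G"
    and b: "b \<in> UNIV \<rightarrow> carrier B"
    and free: "\<And>u. eval_word B b u = \<one>\<^bsub>B\<^esub> \<Longrightarrow> satisfies B {u}"
    and w: "satisfies (A Wr B) {w}"
    and G: "satisfies G (product_laws A B)"
  shows "satisfies G {w}"
  unfolding satisfies_singleton
proof
  fix g :: "nat \<Rightarrow> 'g" assume g: "g \<in> UNIV \<rightarrow> carrier G"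
  interpret A: group A by fact
  interpret B: group B by fact
  interpret G: group G by fact
  obtain N where "N \<lhd> G" and NA: "\<And>w. satisfies A {w} \<Longrightarrow> satisfies (G\<lparr>carrier := N\<rparr>) {w}"
    and NB: "\<And>w. satisfies B {w} \<Longrightarrow> satisfies (G Mod N) {w}"
    using extension_if_satisfies_product_laws[OF assms(3,2) G] by blast
  interpret N: normal N G by fact
  define t where "t = (\<lambda>c. eval_word G g (word_for B b c))"
  define \<sigma> where "\<sigma> = (\<lambda>k. case from_nat k of (u, i) \<Rightarrow>
      eval_word G g u \<otimes>\<^bsub>G\<^esub> g i \<otimes>\<^bsub>G\<^esub> inv\<^bsub>G\<^esub> (t (eval_word B b u \<otimes>\<^bsub>B\<^esub> b i)))"
  have \<sigma>N: "\<sigma> k \<in> N" for k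
  proof -
    obtain u i where k: "from_nat k = (u :: word, i :: nat)" by force
    let ?u = "u @ [(i, True)]"
    have "b i \<in> carrier B" "g i \<in> carrier G" using b g by auto
    then have u: "eval_word B b ?u = eval_word B b u \<otimes>\<^bsub>B\<^esub> b i"
      "eval_word G g ?u = eval_word G g u \<otimes>\<^bsub>G\<^esub> g i"
      using b g by (simp_all add: B.eval_word_append G.eval_word_append)
    define u' where "u' = word_for B b (eval_word B b ?u)"
    have "eval_word B b u' = eval_word B b ?u"
      unfolding u'_def by (rule eval_word_for) blast
    then have "eval_word B b (?u @ inv_word u') = \<one>\<^bsub>B\<^esub>"
      using b by (simp add: B.eval_word_append[of _ ?u] B.eval_word_inv del: append_assoc)
    then have "eval_word G g (?u @ inv_word u') \<in> N"
      using free NB N.eval_word_in_normal g by blast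
    then show ?thesis
      using g by (simp add: \<sigma>_def k t_def u u'_def G.eval_word_append[of _ ?u] G.eval_word_inv del: append_assoc)
  qed
  \<comment> \<open>The labels in \<open>A\<close> are arbitrary, so the coordinate at the identity says that the edge word is a law.\<close>
  have trace: "eval_word B b w = \<one>\<^bsub>B\<^esub>" "satisfies A {trace_word B b \<one>\<^bsub>B\<^esub> w}"
  proof -
    have *: "eval_word B b w = \<one>\<^bsub>B\<^esub> \<and> eval_word A \<tau> (trace_word B b \<one>\<^bsub>B\<^esub> w) = \<one>\<^bsub>A\<^esub>"
      if \<tau>: "\<tau> \<in> UNIV \<rightarrow> carrier A" for \<tau> :: "nat \<Rightarrow> 'a"
    proof -
      have "eval_word (A Wr B) (\<lambda>i. (\<lambda>c\<in>carrier B. \<tau> (edge B b c i), b i)) w = \<one>\<^bsub>A Wr B\<^esub>"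
        using w \<tau> b unfolding satisfies_singleton
        by (elim bspec) (auto simp: carrier_wreath Pi_iff)
      then have "(\<lambda>c\<in>carrier B. eval_word A \<tau> (trace_word B b c w)) = (\<lambda>c\<in>carrier B. \<one>\<^bsub>A\<^esub>)"
        and "eval_word B b w = \<one>\<^bsub>B\<^esub>"
        unfolding eval_word_wreath[OF assms(1,2) b \<tau>] by (simp_all add: one_wreath)
      then show ?thesis by (metis B.one_closed restrict_apply')
    qed
    show "eval_word B b w = \<one>\<^bsub>B\<^esub>" using *[of "\<lambda>_. \<one>\<^bsub>A\<^esub>"] by simp
    show "satisfies A {trace_word B b \<one>\<^bsub>B\<^esub> w}" using * by (simp add: satisfies_singleton)
  qed
  have "eval_word G \<sigma> (trace_word B b \<one>\<^bsub>B\<^esub> w) = \<one>\<^bsub>G\<^esub>"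
    using bspec[OF NA[OF trace(2), unfolded satisfies_singleton], of \<sigma>] \<sigma>N
      G.eval_word_subgroup[OF N.subgroup_axioms, of \<sigma>]
    by auto
  moreover have "\<one>\<^bsub>B\<^esub> \<in> range (eval_word B b)" by (metis eval_word_Nil rangeI)
  ultimately have conj: "t \<one>\<^bsub>B\<^esub> \<otimes>\<^bsub>G\<^esub> eval_word G g w \<otimes>\<^bsub>G\<^esub> inv\<^bsub>G\<^esub> (t \<one>\<^bsub>B\<^esub>) = \<one>\<^bsub>G\<^esub>"
    using eval_trace_word[OF assms(3,2) g b, of t \<sigma> "\<one>\<^bsub>B\<^esub>" w] trace(1)
    by (simp add: t_def \<sigma>_def)
  have c: "t \<one>\<^bsub>B\<^esub> \<in> carrier G" "eval_word G g w \<in> carrier G" using g by (simp_all add: t_def)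
  then have "t \<one>\<^bsub>B\<^esub> \<otimes>\<^bsub>G\<^esub> eval_word G g w =
      t \<one>\<^bsub>B\<^esub> \<otimes>\<^bsub>G\<^esub> eval_word G g w \<otimes>\<^bsub>G\<^esub> inv\<^bsub>G\<^esub> (t \<one>\<^bsub>B\<^esub>) \<otimes>\<^bsub>G\<^esub> t \<one>\<^bsub>B\<^esub>"
    by (simp add: G.m_assoc)
  also have "\<dots> = t \<one>\<^bsub>B\<^esub>" unfolding conj using c(1) by simp
  finally show "eval_word G g w = \<one>\<^bsub>G\<^esub>" using c by simp
qed

text \<open>Modulo the base group, \<open>A Wr B\<close> is \<open>B\<close>, and the base group is a power of \<open>A\<close>.\<close>

lemma wreath_satisfies_product_laws:
  fixes A :: "('a, 'm1) monoid_scheme" and B :: "('b, 'm2) monoid_scheme"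
  assumes "group A" "group B"
  shows "satisfies (A Wr B) (product_laws A B)"
  unfolding satisfies_def
proof (intro ballI)
  fix u and s :: "nat \<Rightarrow> ('b \<Rightarrow> 'a) \<times> 'b"
  assume "u \<in> product_laws A B" and s: "s \<in> UNIV \<rightarrow> carrier (A Wr B)"
  then obtain \<sigma> w where u: "u = subst_word \<sigma> w" and w: "satisfies A {w}"
    and \<sigma>: "\<And>i. satisfies B {\<sigma> i}"
    by (auto simp: product_laws_def)
  interpret A: group A by fact
  interpret B: group B by fact
  interpret W: group "A Wr B" by (rule group_wreath_product) fact+
  interpret snd: group_hom "A Wr B" B snd
    by unfold_locales (auto simp: hom_def carrier_wreath)
  have base: "eval_word (A Wr B) f w = (\<lambda>c\<in>carrier B. eval_word A (\<lambda>i. fst (f i) c) w, \<one>\<^bsub>B\<^esub>)"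
    if f: "\<And>i. f i \<in> carrier (A Wr B)" "\<And>i. snd (f i) = \<one>\<^bsub>B\<^esub>" for f w
  proof (induction w)
    case (Cons l w)
    obtain i pos where l: "l = (i, pos)" by force
    obtain h where h: "f i = (h, \<one>\<^bsub>B\<^esub>)" using f(2)[of i] by (cases "f i") auto
    then have "(h, \<one>\<^bsub>B\<^esub>) \<in> carrier (A Wr B)" using f(1)[of i] by simp
    from inv_wreath[OF assms this] show ?case
      by (auto simp: l h Cons cong: restrict_cong)
  qed (auto simp: one_wreath)
  have "snd (eval_word (A Wr B) s (\<sigma> i)) = \<one>\<^bsub>B\<^esub>" for i
    using s \<sigma>[of i] by (auto simp: snd.eval_word_hom satisfies_singleton Pi_iff carrier_wreath)
  moreover have f: "eval_word (A Wr B) s (\<sigma> i) \<in> carrier (A Wr B)" for i using s by simp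
  moreover have "eval_word A (\<lambda>i. fst (eval_word (A Wr B) s (\<sigma> i)) c) w = \<one>\<^bsub>A\<^esub>"
    if "c \<in> carrier B" for c
  proof -
    have "fst (eval_word (A Wr B) s (\<sigma> i)) c \<in> carrier A" for i
      using f[of i] that by (auto simp: carrier_wreath)
    then show ?thesis using w by (auto simp: satisfies_singleton)
  qed
  ultimately show "eval_word (A Wr B) s u = \<one>\<^bsub>A Wr B\<^esub>"
    using s by (simp add: u W.eval_word_subst base one_wreath cong: restrict_cong)
qed

section \<open>Laws of abelian groups\<close>

fun exponent_sum :: "word \<Rightarrow> nat \<Rightarrow> int" where
  "exponent_sum [] i = 0"
| "exponent_sum ((j, pos) # w) i = (if j = i then if pos then 1 else - 1 else 0) + exponent_sum w i"

lemma (in group) eval_word_single: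
  assumes "x \<in> carrier G"
  shows "eval_word G (\<lambda>j. if j = i then x else \<one>) w = x [^] exponent_sum w i"
proof (induction w)
  case (Cons l w)
  obtain j pos where "l = (j, pos)" by force
  with assms Cons show ?case by (auto simp: int_pow_mult int_pow_neg)
qed simp

lemma (in comm_group) eval_word_mult:
  assumes "s \<in> UNIV \<rightarrow> carrier G" "t \<in> UNIV \<rightarrow> carrier G"
  shows "eval_word G (\<lambda>i. s i \<otimes> t i) w = eval_word G s w \<otimes> eval_word G t w"
proof (induction w)
  case (Cons l w)
  obtain j pos where "l = (j, pos)" by force
  moreover have "s j \<in> carrier G" "t j \<in> carrier G" using assms by auto
  ultimately show ?case using assms Cons by (simp add: inv_mult m_ac)
qed simp

lemma eval_word_cong:
  "(\<And>i. i \<in> fst ` set w \<Longrightarrow> s i = t i) \<Longrightarrow> eval_word G s w = eval_word G t w"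
  by (induction w) auto

text \<open>In an abelian group evaluation is a homomorphism in the assignment, so the variables can be
  treated one at a time.\<close>

lemma (in comm_group) satisfies_if_exponent_sums:
  assumes "\<And>x i. x \<in> carrier G \<Longrightarrow> x [^] exponent_sum w i = \<one>"
  shows "satisfies G {w}"
  unfolding satisfies_singleton
proof
  fix s :: "nat \<Rightarrow> _" assume s: "s \<in> UNIV \<rightarrow> carrier G"
  \<comment> \<open>The assignment restricted to the first \<open>m\<close> variables is a product of assignments to single variables.\<close>
  have trunc: "eval_word G (\<lambda>i. if i < m then s i else \<one>) w = \<one>" for m
  proof (induction m)
    case 0
    have "eval_word G (\<lambda>i. \<one>) w = \<one>" by (induction w) auto
    then show ?case by simp
  next
    case (Suc m)
    have "(\<lambda>i. if i < Suc m then s i else \<one>) =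
        (\<lambda>i. (if i = m then s m else \<one>) \<otimes> (if i < m then s i else \<one>))"
      using s by (auto simp: Pi_iff fun_eq_iff less_Suc_eq)
    moreover have "s m \<in> carrier G" "(\<lambda>i. if i = m then s m else \<one>) \<in> UNIV \<rightarrow> carrier G"
      "(\<lambda>i. if i < m then s i else \<one>) \<in> UNIV \<rightarrow> carrier G"
      using s by auto
    ultimately show ?case using Suc assms
      by (simp add: eval_word_mult eval_word_single)
  qed
  obtain m where m: "\<And>i. i \<in> fst ` set w \<Longrightarrow> i < m"
    using finite_nat_set_iff_bounded[of "fst ` set w"] by auto
  have "eval_word G s w = eval_word G (\<lambda>i. if i < m then s i else \<one>) w"
    using m by (intro eval_word_cong) simp
  then show "eval_word G s w = \<one>" by (simp add: trunc)
qed

text \<open>The exponent is defined as the least positive one; it divides all others because \<open>gcd n k\<close> is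
  an exponent as well.\<close>

lemma has_exponent_int_pow_iff:
  assumes "group G" "has_exponent G n"
  shows "(\<forall>x\<in>carrier G. x [^]\<^bsub>G\<^esub> (k :: int) = \<one>\<^bsub>G\<^esub>) \<longleftrightarrow> int n dvd k"
proof
  interpret group G by fact
  have n: "n > 0" "\<And>x. x \<in> carrier G \<Longrightarrow> group.ord G x dvd n"
    "\<And>m. m > 0 \<Longrightarrow> \<forall>x\<in>carrier G. x [^]\<^bsub>G\<^esub> m = \<one>\<^bsub>G\<^esub> \<Longrightarrow> n \<le> m"
    using assms(2) by (auto simp: has_exponent_def pow_eq_id)
  {
    assume "\<forall>x\<in>carrier G. x [^]\<^bsub>G\<^esub> k = \<one>\<^bsub>G\<^esub>"
    then have "x [^]\<^bsub>G\<^esub> gcd n (nat \<bar>k\<bar>) = \<one>\<^bsub>G\<^esub>" if "x \<in> carrier G" for x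
      using n(2)[OF that] that by (simp add: int_pow_eq_id pow_eq_id)
    then have "n \<le> gcd n (nat \<bar>k\<bar>)" using n(1) by (intro n(3)) simp_all
    then have "gcd n (nat \<bar>k\<bar>) = n" using n(1) gcd_le1_nat[of n "nat \<bar>k\<bar>"] by linarith
    then have "n dvd nat \<bar>k\<bar>" by (metis gcd_dvd2)
    then show "int n dvd k" by simp
  next
    assume "int n dvd k"
    then show "\<forall>x\<in>carrier G. x [^]\<^bsub>G\<^esub> k = \<one>\<^bsub>G\<^esub>"
      using n(2) by (simp add: int_pow_eq_id) (meson dvd_trans int_dvd_int_iff)
  }
qed

lemma abelian_law_iff:
  assumes "comm_group B" "has_exponent B n"
  shows "satisfies B {w} \<longleftrightarrow> (\<forall>i. int n dvd exponent_sum w i)"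
proof
  interpret comm_group B by fact
  {
    assume w: "satisfies B {w}"
    have "x [^]\<^bsub>B\<^esub> exponent_sum w i = \<one>\<^bsub>B\<^esub>" if "x \<in> carrier B" for x i
    proof -
      have "(\<lambda>j. if j = i then x else \<one>\<^bsub>B\<^esub>) \<in> UNIV \<rightarrow> carrier B" using that by auto
      then show ?thesis using w eval_word_single[OF that] by (metis satisfies_singleton)
    qed
    then show "\<forall>i. int n dvd exponent_sum w i"
      using has_exponent_int_pow_iff[OF is_group assms(2)] by blast
  next
    assume "\<forall>i. int n dvd exponent_sum w i"
    then show "satisfies B {w}"
      using has_exponent_int_pow_iff[OF is_group assms(2)] by (blast intro: satisfies_if_exponent_sums)
  }
qed

lemma var_gen_abelian:
  assumes "comm_group B" "has_exponent B n"
  shows "var_gen B = abelian_variety n"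
proof (rule subset_antisym; rule subsetI)
  interpret B: comm_group B by fact
  fix G :: "'g monoid" assume "G \<in> var_gen B"
  then have "group G" and laws: "\<And>w. satisfies B {w} \<Longrightarrow> satisfies G {w}" by (auto simp: var_gen_iff)
  interpret G: group G by fact
  have comm: "satisfies G {[(0, True), (1, True), (0, False), (1, False)]}"
    by (rule laws) (simp add: abelian_law_iff[OF assms])
  have pow: "satisfies G {power_word [(0, True)] n}"
    using assms(2) by (intro laws) (auto simp: satisfies_singleton B.eval_word_power has_exponent_def Pi_iff)
  have "comm_group G"
  proof (rule G.group_comm_groupI)
    fix x y assume xy: "x \<in> carrier G" "y \<in> carrier G"
    then have "(\<lambda>i::nat. if i = 0 then x else y) \<in> UNIV \<rightarrow> carrier G" by auto
    then have "x \<otimes>\<^bsub>G\<^esub> (y \<otimes>\<^bsub>G\<^esub> (inv\<^bsub>G\<^esub> x \<otimes>\<^bsub>G\<^esub> inv\<^bsub>G\<^esub> y)) = \<one>\<^bsub>G\<^esub>"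
      using comm xy unfolding satisfies_singleton by fastforce
    then have "(x \<otimes>\<^bsub>G\<^esub> y) \<otimes>\<^bsub>G\<^esub> inv\<^bsub>G\<^esub> (y \<otimes>\<^bsub>G\<^esub> x) = \<one>\<^bsub>G\<^esub>"
      using xy by (simp add: G.inv_mult_group G.m_assoc)
    then show "x \<otimes>\<^bsub>G\<^esub> y = y \<otimes>\<^bsub>G\<^esub> x"
      using xy by (metis G.inv_closed G.inv_equality G.inv_inv G.m_closed)
  qed
  moreover have "x [^]\<^bsub>G\<^esub> n = \<one>\<^bsub>G\<^esub>" if x: "x \<in> carrier G" for x
  proof -
    have "(\<lambda>_. x) \<in> UNIV \<rightarrow> carrier G" using x by auto
    then have "eval_word G (\<lambda>_. x) (power_word [(0, True)] n) = \<one>\<^bsub>G\<^esub>"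
      using pow by (metis satisfies_singleton)
    then show ?thesis using x by (simp add: G.eval_word_power)
  qed
  ultimately show "G \<in> abelian_variety n" by (simp add: abelian_variety_def)
next
  fix G :: "'g monoid" assume "G \<in> abelian_variety n"
  then have "comm_group G" and n: "\<And>x. x \<in> carrier G \<Longrightarrow> x [^]\<^bsub>G\<^esub> n = \<one>\<^bsub>G\<^esub>"
    by (auto simp: abelian_variety_def)
  interpret G: comm_group G by fact
  have "satisfies G {w}" if "satisfies B {w}" for w
  proof (rule G.satisfies_if_exponent_sums)
    fix x i assume x: "x \<in> carrier G"
    have "int n dvd exponent_sum w i" using that abelian_law_iff[OF assms] by blast
    then show "x [^]\<^bsub>G\<^esub> exponent_sum w i = \<one>\<^bsub>G\<^esub>"
      using n[OF x] x by (simp add: G.int_pow_eq_id G.pow_eq_id) (meson dvd_trans int_dvd_int_iff)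
  qed
  then show "G \<in> var_gen B" by (simp add: var_gen_iff G.is_group)
qed

section \<open>Infinite sums of copies of a cyclic group\<close>

definition cyclic_sum :: "nat \<Rightarrow> (nat \<Rightarrow> int) monoid" where
  "cyclic_sum n = sum_group UNIV (\<lambda>_. integer_mod_group n)"

text \<open>The residue \<open>1 mod n\<close> rather than \<open>1\<close> keeps the vector in the carrier for \<open>n = 1\<close>.\<close>

definition unit_vector :: "nat \<Rightarrow> nat \<Rightarrow> (nat \<Rightarrow> int)" where
  "unit_vector n i = (\<lambda>j. if j = i then 1 mod int n else 0)"

lemma carrier_cyclic_sum:
  "carrier (cyclic_sum n) = {x. (\<forall>i. x i \<in> carrier (integer_mod_group n)) \<and> finite {i. x i \<noteq> 0}}"
  by (auto simp: cyclic_sum_def carrier_sum_group)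

lemma mult_cyclic_sum [simp]: "x \<otimes>\<^bsub>cyclic_sum n\<^esub> y = (\<lambda>i. (x i + y i) mod int n)"
  by (auto simp: cyclic_sum_def)

lemma one_cyclic_sum [simp]: "\<one>\<^bsub>cyclic_sum n\<^esub> = (\<lambda>i. 0)"
  by (auto simp: cyclic_sum_def)

lemma comm_group_cyclic_sum: "comm_group (cyclic_sum n)"
proof -
  interpret group "cyclic_sum n" by (simp add: cyclic_sum_def)
  show ?thesis by (rule group_comm_groupI) (simp add: add.commute)
qed

lemma unit_vector_carrier: "unit_vector n i \<in> carrier (cyclic_sum n)"
  by (auto simp: carrier_cyclic_sum unit_vector_def carrier_integer_mod_group)

lemma cyclic_sum_pow: "x [^]\<^bsub>cyclic_sum n\<^esub> (k :: nat) = (\<lambda>i. (int k * x i) mod int n)"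
proof (induction k)
  case (Suc k)
  interpret comm_group "cyclic_sum n" by (rule comm_group_cyclic_sum)
  show ?case by (simp add: Suc nat_pow_Suc algebra_simps mod_add_right_eq)
qed simp

lemma eval_word_unit_vectors:
  "eval_word (cyclic_sum n) (unit_vector n) w i = exponent_sum w i mod int n"
proof -
  interpret Q: comm_group "cyclic_sum n" by (rule comm_group_cyclic_sum)
  interpret proj: group_hom "cyclic_sum n" "integer_mod_group n" "\<lambda>x. x i"
    using group_integer_mod_group Q.is_group
    by (auto simp: group_hom_def group_hom_axioms_def hom_def carrier_cyclic_sum)
  have "eval_word (cyclic_sum n) (unit_vector n) w i
      = eval_word (integer_mod_group n) (\<lambda>j. if j = i then 1 mod int n else \<one>\<^bsub>integer_mod_group n\<^esub>) w"
  proof -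
    have "unit_vector n \<in> UNIV \<rightarrow> carrier (cyclic_sum n)" by (simp add: unit_vector_carrier)
    moreover have "(\<lambda>j. unit_vector n j i) =
        (\<lambda>j. if j = i then 1 mod int n else \<one>\<^bsub>integer_mod_group n\<^esub>)"
      by (auto simp: unit_vector_def)
    ultimately show ?thesis using proj.eval_word_hom[of "unit_vector n" w] by simp
  qed
  also have "\<dots> = exponent_sum w i mod int n"
    by (subst group.eval_word_single)
      (auto simp: int_pow_integer_mod_group carrier_integer_mod_group mod_mult_right_eq)
  finally show ?thesis .
qed

text \<open>The sequence consists of the images of the unit vectors. A relation between these makes all
  exponent sums divisible by \<open>n\<close>, which is the condition for being a law.\<close>

lemma free_sequence_if_contains_cyclic_sum:
  assumes "comm_group B" "has_exponent B n"
    and "subgroup H B" "B\<lparr>carrier := H\<rparr> \<cong> cyclic_sum n"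
  obtains b where "b \<in> UNIV \<rightarrow> carrier B"
    and "\<And>u. eval_word B b u = \<one>\<^bsub>B\<^esub> \<Longrightarrow> satisfies B {u}"
proof -
  interpret B: comm_group B by fact
  interpret BH: group "B\<lparr>carrier := H\<rparr>" using assms(3) B.is_group by (rule subgroup.subgroup_is_group)
  interpret Q: comm_group "cyclic_sum n" by (rule comm_group_cyclic_sum)
  obtain f where f: "f \<in> iso (cyclic_sum n) (B\<lparr>carrier := H\<rparr>)"
    using BH.iso_sym[OF assms(4)] by (auto simp: is_iso_def)
  interpret f: group_hom "cyclic_sum n" "B\<lparr>carrier := H\<rparr>" f
    using f by unfold_locales (auto simp: iso_def)
  define b where "b i = f (unit_vector n i)" for i
  have e: "unit_vector n \<in> UNIV \<rightarrow> carrier (cyclic_sum n)" by (simp add: unit_vector_carrier)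
  have bH: "b \<in> UNIV \<rightarrow> H" unfolding b_def using f.hom_closed[OF unit_vector_carrier] by auto
  have "satisfies B {u}" if "eval_word B b u = \<one>\<^bsub>B\<^esub>" for u
  proof -
    have "f (eval_word (cyclic_sum n) (unit_vector n) u) = \<one>\<^bsub>B\<^esub>"
      using that B.eval_word_subgroup[OF assms(3) bH, of u] f.eval_word_hom[OF e, of u]
      by (simp add: b_def[abs_def])
    moreover have "f \<one>\<^bsub>cyclic_sum n\<^esub> = \<one>\<^bsub>B\<^esub>" using f.hom_one by simp
    moreover have "inj_on f (carrier (cyclic_sum n))" using f by (auto simp: iso_def bij_betw_def)
    ultimately have "eval_word (cyclic_sum n) (unit_vector n) u = \<one>\<^bsub>cyclic_sum n\<^esub>"
      using Q.eval_word_closed[OF e] by (metis Q.one_closed inj_onD)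
    then have "int n dvd exponent_sum u i" for i
      using eval_word_unit_vectors[of n u i] by (simp add: mod_0_imp_dvd)
    then show ?thesis by (simp add: abelian_law_iff[OF assms(1,2)])
  qed
  moreover have "b \<in> UNIV \<rightarrow> carrier B" using bH assms(3) subgroup.subset by fastforce
  ultimately show thesis using that by blast
qed

section \<open>Norms along conjugation\<close>

text \<open>The norm \<open>u (z u z\<^sup>-\<^sup>1) \<cdots> (z\<^sup>n\<^sup>-\<^sup>1 u z\<^sup>1\<^sup>-\<^sup>n)\<close> of \<open>u\<close> with respect to conjugation by \<open>z\<close>, in the
  form that is short as a word. The recursion for the product is \<open>conj_norm_Suc\<close>.\<close>

definition conj_norm :: "('a, 'm) monoid_scheme \<Rightarrow> nat \<Rightarrow> 'a \<Rightarrow> 'a \<Rightarrow> 'a" where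
  "conj_norm G n z u = (u \<otimes>\<^bsub>G\<^esub> z) [^]\<^bsub>G\<^esub> n \<otimes>\<^bsub>G\<^esub> inv\<^bsub>G\<^esub> (z [^]\<^bsub>G\<^esub> n)"

context group
begin

lemma conj_norm_closed [simp]:
  "z \<in> carrier G \<Longrightarrow> u \<in> carrier G \<Longrightarrow> conj_norm G n z u \<in> carrier G"
  by (simp add: conj_norm_def)

lemma conj_norm_0 [simp]: "conj_norm G 0 z u = \<one>"
  by (simp add: conj_norm_def)

lemma conj_norm_Suc:
  assumes "z \<in> carrier G" "u \<in> carrier G"
  shows "conj_norm G (Suc n) z u = u \<otimes> (z \<otimes> conj_norm G n z u \<otimes> inv z)"
proof -
  have "inv (z [^] Suc n) = inv (z [^] n) \<otimes> inv z"
    unfolding nat_pow_Suc2[OF assms(1)] using assms by (simp add: inv_mult_group)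
  moreover have "(u \<otimes> z) [^] Suc n = u \<otimes> z \<otimes> (u \<otimes> z) [^] n"
    using assms by (intro nat_pow_Suc2) simp
  ultimately show ?thesis using assms by (simp add: conj_norm_def m_assoc)
qed

lemma conj_norm_Suc_right:
  assumes "z \<in> carrier G" "u \<in> carrier G" "z [^] n \<otimes> u = u \<otimes> z [^] n"
  shows "conj_norm G (Suc n) z u = conj_norm G n z u \<otimes> u"
proof -
  have "inv (z [^] Suc n) = inv z \<otimes> inv (z [^] n)"
    using assms by (simp add: inv_mult_group)
  then have "conj_norm G (Suc n) z u = (u \<otimes> z) [^] n \<otimes> u \<otimes> inv (z [^] n)"
    using assms by (simp add: conj_norm_def m_assoc) (simp flip: m_assoc)
  moreover have "u \<otimes> inv (z [^] n) = inv (z [^] n) \<otimes> u"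
    using assms by (metis inv_solve_left inv_solve_right m_assoc m_closed inv_closed nat_pow_closed)
  ultimately show ?thesis using assms by (simp add: conj_norm_def m_assoc)
qed

lemma fold_conj_norm_closed:
  "set zs \<subseteq> carrier G \<Longrightarrow> u \<in> carrier G \<Longrightarrow> fold (conj_norm G n) zs u \<in> carrier G"
  by (induction zs arbitrary: u) auto

lemma foldr_mult_closed:
  "set zs \<subseteq> carrier G \<Longrightarrow> foldr (\<otimes>) zs \<one> \<in> carrier G"
  by (induction zs) auto

lemma foldr_mult_append:
  "set xs \<subseteq> carrier G \<Longrightarrow> set ys \<subseteq> carrier G \<Longrightarrow>
    foldr (\<otimes>) (xs @ ys) \<one> = foldr (\<otimes>) xs \<one> \<otimes> foldr (\<otimes>) ys \<one>"
  by (induction xs) (simp_all add: m_assoc foldr_mult_closed)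

lemma commute_mult:
  assumes "x \<in> carrier G" "y \<in> carrier G" "v \<in> carrier G"
    and "x \<otimes> v = v \<otimes> x" "y \<otimes> v = v \<otimes> y"
  shows "(x \<otimes> y) \<otimes> v = v \<otimes> (x \<otimes> y)"
  using assms by (metis m_assoc)

lemma commute_inv:
  assumes "x \<in> carrier G" "v \<in> carrier G" "x \<otimes> v = v \<otimes> x"
  shows "inv x \<otimes> v = v \<otimes> inv x"
  using assms by (metis inv_solve_left inv_solve_right m_assoc m_closed inv_closed)

lemma commute_foldr:
  assumes "v \<in> carrier G" "set ys \<subseteq> carrier G" "\<forall>y\<in>set ys. y \<otimes> v = v \<otimes> y"
  shows "foldr (\<otimes>) ys \<one> \<otimes> v = v \<otimes> foldr (\<otimes>) ys \<one>"
  using assms(2,3)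
proof (induction ys)
  case (Cons y ys)
  then show ?case
    using commute_mult[of y "foldr (\<otimes>) ys \<one>" v] assms(1) by (simp add: foldr_mult_closed)
qed (use assms(1) in simp)

end

context group_hom
begin

lemma hom_conj_norm:
  "z \<in> carrier G \<Longrightarrow> u \<in> carrier G \<Longrightarrow> h (conj_norm G n z u) = conj_norm H n (h z) (h u)"
  by (simp add: conj_norm_def hom_nat_pow)

lemma hom_fold_conj_norm:
  "set zs \<subseteq> carrier G \<Longrightarrow> u \<in> carrier G \<Longrightarrow>
    h (fold (conj_norm G n) zs u) = fold (conj_norm H n) (map h zs) (h u)"
  by (induction zs arbitrary: u) (auto simp: hom_conj_norm)

lemma hom_foldr_mult:
  "set zs \<subseteq> carrier G \<Longrightarrow> h (foldr (\<otimes>\<^bsub>G\<^esub>) zs \<one>\<^bsub>G\<^esub>) = foldr (\<otimes>\<^bsub>H\<^esub>) (map h zs) \<one>\<^bsub>H\<^esub>"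
  by (induction zs) (auto simp: G.foldr_mult_closed)

end

text \<open>A factor of a central series of the base group, seen in the quotient by the lower term. Here
  \<open>K\<close> is an abelian normal subgroup on which the group acts by conjugation through its quotient
  by \<open>M\<close>, and norms are the norm endomorphisms of that action.\<close>

locale central_layer = normal K G for K and G (structure) +
  fixes M
  assumes M: "subgroup M G" "K \<subseteq> M"
    and central: "\<And>m k. m \<in> M \<Longrightarrow> k \<in> K \<Longrightarrow> m \<otimes> k = k \<otimes> m"
begin

lemma K_carrier [simp]: "k \<in> K \<Longrightarrow> k \<in> carrier G"
  using subset by auto

lemma M_carrier [simp]: "m \<in> M \<Longrightarrow> m \<in> carrier G"
  using M(1) subgroup.subset by auto

lemma K_commute: "k \<in> K \<Longrightarrow> l \<in> K \<Longrightarrow> k \<otimes> l = l \<otimes> k"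
  using central M(2) by blast

lemma conj_norm_in_K:
  "z \<in> carrier G \<Longrightarrow> u \<in> K \<Longrightarrow> conj_norm G n z u \<in> K"
  by (induction n) (auto simp: conj_norm_Suc inv_op_closed2)

lemma fold_conj_norm_in_K:
  "set zs \<subseteq> carrier G \<Longrightarrow> u \<in> K \<Longrightarrow> fold (conj_norm G n) zs u \<in> K"
  by (induction zs arbitrary: u) (auto simp: conj_norm_in_K)

lemma conj_norm_mult:
  assumes z: "z \<in> carrier G" and u: "u \<in> K" "u' \<in> K"
  shows "conj_norm G n z (u \<otimes> u') = conj_norm G n z u \<otimes> conj_norm G n z u'"
proof (induction n)
  case (Suc n)
  let ?c = "\<lambda>x. z \<otimes> x \<otimes> inv z"
  let ?N = "conj_norm G n z u" and ?N' = "conj_norm G n z u'"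
  have N: "?N \<in> K" "?N' \<in> K" using z u by (simp_all add: conj_norm_in_K)
  then have c: "?c ?N \<in> K" "?c ?N' \<in> K" using z by (simp_all add: inv_op_closed2)
  have "inv z \<otimes> (z \<otimes> y) = y" if "y \<in> carrier G" for y using z that by (simp flip: m_assoc)
  then have "?c (?N \<otimes> ?N') = ?c ?N \<otimes> ?c ?N'" using N z by (simp add: m_assoc)
  then have "conj_norm G (Suc n) z (u \<otimes> u') = u \<otimes> (u' \<otimes> ?c ?N) \<otimes> ?c ?N'"
    using Suc u z N c by (simp add: conj_norm_Suc m_assoc)
  also have "\<dots> = (u \<otimes> ?c ?N) \<otimes> (u' \<otimes> ?c ?N')"
    using u c by (simp add: K_commute[of u'] m_assoc[of _ _ "?c ?N'"] K_carrier) (simp add: m_assoc)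
  finally show ?case using u z by (simp add: conj_norm_Suc)
qed simp

lemma conj_norm_fixed:
  assumes "z \<in> carrier G" "u \<in> K" "z \<otimes> u = u \<otimes> z"
  shows "conj_norm G n z u = u [^] n"
proof (induction n)
  case (Suc n)
  have "z \<otimes> u [^] n \<otimes> inv z = u [^] n"
    using assms by (metis K_carrier group_commutes_pow inv_solve_right m_closed nat_pow_closed)
  moreover have "u [^] Suc n = u \<otimes> u [^] n" using assms by (intro nat_pow_Suc2) simp
  ultimately show ?case using assms Suc by (simp add: conj_norm_Suc)
qed simp

lemma pow_in_K: "u \<in> K \<Longrightarrow> u [^] (k::nat) \<in> K"
  by (induction k) auto

lemma conj_norm_pow:
  assumes "z \<in> carrier G" "u \<in> K"
  shows "conj_norm G n z (u [^] (k::nat)) = conj_norm G n z u [^] k"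
proof (induction k)
  case 0
  show ?case using conj_norm_fixed[of z \<one> n] assms(1) by simp
qed (use assms in \<open>simp add: conj_norm_mult pow_in_K\<close>)

lemma fold_conj_norm_pow:
  "set zs \<subseteq> carrier G \<Longrightarrow> u \<in> K \<Longrightarrow>
    fold (conj_norm G n) zs (u [^] (k::nat)) = fold (conj_norm G n) zs u [^] k"
  by (induction zs arbitrary: u) (auto simp: conj_norm_pow conj_norm_in_K)

text \<open>Conjugation by \<open>z\<close> permutes the factors of the norm cyclically, because \<open>z [^] n\<close> acts
  trivially.\<close>

lemma commutes_own_conj_norm:
  assumes z: "z \<in> carrier G" "z [^] n \<in> M" and u: "u \<in> K"
  shows "z \<otimes> conj_norm G n z u = conj_norm G n z u \<otimes> z"
proof -
  let ?N = "conj_norm G n z u"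
  have N: "?N \<in> K" using z u by (simp add: conj_norm_in_K)
  have "u \<otimes> (z \<otimes> ?N \<otimes> inv z) = ?N \<otimes> u"
    using z u central conj_norm_Suc[of z u n] conj_norm_Suc_right[of z u n] by simp
  also have "\<dots> = u \<otimes> ?N" using u N by (simp add: K_commute)
  finally have "z \<otimes> ?N \<otimes> inv z = ?N" using z u N by simp
  then show ?thesis using z u N by (metis K_carrier inv_solve_right m_closed)
qed

text \<open>If \<open>y\<close> and \<open>z\<close> commute modulo \<open>M\<close>, their actions on \<open>K\<close> commute, so a norm along \<open>z\<close> does not
  destroy that an element is fixed by \<open>y\<close>.\<close>

lemma commutes_conj_norm:
  assumes z: "z \<in> carrier G" and y: "y \<in> carrier G" and u: "u \<in> K"
    and m: "m \<in> M" "y \<otimes> z = z \<otimes> y \<otimes> m" and yu: "y \<otimes> u = u \<otimes> y"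
  shows "y \<otimes> conj_norm G n z u = conj_norm G n z u \<otimes> y"
proof (induction n)
  case (Suc n)
  let ?N = "conj_norm G n z u"
  have N: "?N \<in> K" using z u by (simp add: conj_norm_in_K)
  have ym: "y \<otimes> m = inv z \<otimes> y \<otimes> z"
    using z y m by (simp add: m_assoc) (simp flip: m_assoc)
  have c: "?N \<in> carrier G" "u \<in> carrier G" "m \<in> carrier G" using N u m by auto
  have "y \<otimes> (u \<otimes> (z \<otimes> ?N \<otimes> inv z)) = u \<otimes> (y \<otimes> z) \<otimes> ?N \<otimes> inv z"
    using yu z y c by (metis m_assoc m_closed inv_closed)
  also have "\<dots> = u \<otimes> z \<otimes> (y \<otimes> m \<otimes> ?N) \<otimes> inv z"
    using m(2) z y c by (simp add: m_assoc)
  also have "y \<otimes> m \<otimes> ?N = ?N \<otimes> (y \<otimes> m)"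
    using commute_mult[of y m ?N] Suc central[OF m(1) N] y c by simp
  also have "u \<otimes> z \<otimes> (?N \<otimes> (y \<otimes> m)) \<otimes> inv z = u \<otimes> (z \<otimes> ?N \<otimes> inv z) \<otimes> y"
    unfolding ym using z y c by (simp add: m_assoc)
  finally show ?case using z u by (simp add: conj_norm_Suc)
qed (use y in simp)

lemma commutes_fold_conj_norm:
  assumes "set zs \<subseteq> carrier G" "\<forall>z\<in>set zs. z [^] n \<in> M"
    and "\<forall>y\<in>set zs. \<forall>z\<in>set zs. \<exists>m\<in>M. y \<otimes> z = z \<otimes> y \<otimes> m"
    and "u \<in> K" "y \<in> set zs"
  shows "y \<otimes> fold (conj_norm G n) zs u = fold (conj_norm G n) zs u \<otimes> y"
  using assms
proof (induction zs arbitrary: y rule: rev_induct)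
  case (snoc z zs)
  let ?v = "fold (conj_norm G n) zs u"
  have v: "?v \<in> K" using snoc.prems by (simp add: fold_conj_norm_in_K)
  show ?case
  proof (cases "y = z")
    case True
    then show ?thesis using v snoc.prems commutes_own_conj_norm[of z n ?v] by simp
  next
    case False
    then have "y \<in> set zs" using snoc.prems by auto
    then have "y \<otimes> ?v = ?v \<otimes> y" using snoc by simp
    moreover obtain m where "m \<in> M" "y \<otimes> z = z \<otimes> y \<otimes> m"
      using snoc.prems \<open>y \<in> set zs\<close> by fastforce
    ultimately show ?thesis
      using v snoc.prems commutes_conj_norm[of z y ?v m n] \<open>y \<in> set zs\<close> by auto
  qed
qed simp

text \<open>After the norms along \<open>as @ bs\<close>, the element is fixed by the product of \<open>bs\<close>. Modulo \<open>M\<close> this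
  product is inverse to \<open>z\<close>, so the element is fixed by \<open>z\<close> and its norm along \<open>z\<close> is its \<open>n\<close>-th
  power. The later norms are endomorphisms and preserve \<open>n\<close>-th powers.\<close>

lemma block_gives_power:
  assumes zs: "set zs \<subseteq> carrier G" "\<forall>z\<in>set zs. z [^] n \<in> M"
    "\<forall>y\<in>set zs. \<forall>z\<in>set zs. \<exists>m\<in>M. y \<otimes> z = z \<otimes> y \<otimes> m"
    and split: "zs = as @ bs @ z # cs" "foldr (\<otimes>) bs \<one> \<otimes> z \<in> M"
    and u: "u \<in> K"
  obtains v where "v \<in> K" "fold (conj_norm G n) zs u = v [^] n"
proof
  let ?v = "fold (conj_norm G n) (as @ bs) u"
  let ?P = "foldr (\<otimes>) bs \<one>"
  have v: "?v \<in> K" using zs(1) u split(1) by (intro fold_conj_norm_in_K) auto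
  have carr: "set bs \<subseteq> carrier G" "z \<in> carrier G" "set cs \<subseteq> carrier G" using zs(1) split(1) by auto
  then have P: "?P \<in> carrier G" by (simp add: foldr_mult_closed)
  have "y \<otimes> ?v = ?v \<otimes> y" if "y \<in> set (as @ bs)" for y
    using zs u split(1) that by (intro commutes_fold_conj_norm) auto
  then have "\<forall>y\<in>set bs. y \<otimes> ?v = ?v \<otimes> y" by simp
  then have "?P \<otimes> ?v = ?v \<otimes> ?P" using carr(1) v by (intro commute_foldr) auto
  then have "inv ?P \<otimes> ?v = ?v \<otimes> inv ?P" using v P by (simp add: commute_inv)
  moreover have "(?P \<otimes> z) \<otimes> ?v = ?v \<otimes> (?P \<otimes> z)" using split(2) v central by blast
  ultimately have "(inv ?P \<otimes> (?P \<otimes> z)) \<otimes> ?v = ?v \<otimes> (inv ?P \<otimes> (?P \<otimes> z))"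
    using v P carr commute_mult[of "inv ?P" "?P \<otimes> z" ?v] by simp
  moreover have "inv ?P \<otimes> (?P \<otimes> z) = z" using P carr by (simp flip: m_assoc)
  ultimately have "conj_norm G n z ?v = ?v [^] n"
    using v carr by (intro conj_norm_fixed) auto
  then show "fold (conj_norm G n) zs u = fold (conj_norm G n) cs ?v [^] n"
    using v carr by (simp add: split(1) fold_conj_norm_pow)
  show "fold (conj_norm G n) cs ?v \<in> K" using v carr by (simp add: fold_conj_norm_in_K)
qed

lemma blocks_give_power:
  assumes Z: "Z \<subseteq> carrier G" "\<forall>z\<in>Z. z [^] n \<in> M"
    "\<forall>y\<in>Z. \<forall>z\<in>Z. \<exists>m\<in>M. y \<otimes> z = z \<otimes> y \<otimes> m"
    and split: "\<And>zs. set zs \<subseteq> Z \<Longrightarrow> length zs = N \<Longrightarrow>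
      \<exists>as bs z cs. zs = as @ bs @ z # cs \<and> foldr (\<otimes>) bs \<one> \<otimes> z \<in> M"
    and zs: "set zs \<subseteq> Z" "length zs = e * N" and u: "u \<in> K"
  shows "\<exists>v\<in>K. fold (conj_norm G n) zs u = v [^] (n ^ e)"
  using zs u
proof (induction e arbitrary: zs u)
  case 0
  then show ?case by (auto intro!: bexI[of _ u])
next
  case (Suc e)
  let ?f = "take N zs" and ?r = "drop N zs"
  have f: "set ?f \<subseteq> Z" "length ?f = N" using Suc.prems by (auto dest: in_set_takeD)
  have r: "set ?r \<subseteq> Z" "length ?r = e * N" using Suc.prems by (auto dest: in_set_dropD)
  obtain as bs z cs where s: "?f = as @ bs @ z # cs" "foldr (\<otimes>) bs \<one> \<otimes> z \<in> M"
    using split[OF f] by blast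
  have c: "set ?f \<subseteq> carrier G" "\<forall>z\<in>set ?f. z [^] n \<in> M"
    "\<forall>y\<in>set ?f. \<forall>z\<in>set ?f. \<exists>m\<in>M. y \<otimes> z = z \<otimes> y \<otimes> m" using f(1) Z by (blast, blast, blast)
  obtain w where w: "w \<in> K" "fold (conj_norm G n) ?f u = w [^] n"
    by (rule block_gives_power[OF c s Suc.prems(3)])
  obtain v where v: "v \<in> K" "fold (conj_norm G n) ?r w = v [^] (n ^ e)"
    using Suc.IH[OF r w(1)] by blast
  have "fold (conj_norm G n) zs u = fold (conj_norm G n) ?r (fold (conj_norm G n) ?f u)"
    by (metis append_take_drop_id comp_apply fold_append)
  also have "\<dots> = v [^] (n ^ Suc e)"
    using r(1) Z w v by (simp add: fold_conj_norm_pow nat_pow_pow mult.commute)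
  finally show ?case using v by blast
qed

end

text \<open>The conclusion of the locale \<open>central_layer\<close> for \<open>K\<close> modulo \<open>L\<close>, lifted to the group itself:
  as \<open>n ^ e\<close>-th powers of elements of \<open>K\<close> lie in \<open>L\<close>, \<open>e\<close> blocks lead from \<open>K\<close> into \<open>L\<close>.\<close>

lemma (in group) norms_descend:
  assumes K: "K \<lhd> G" and L: "L \<lhd> G" "L \<subseteq> K" and M: "subgroup M G" "K \<subseteq> M"
    and comm: "\<And>m k. m \<in> M \<Longrightarrow> k \<in> K \<Longrightarrow> \<exists>l\<in>L. m \<otimes> k = k \<otimes> m \<otimes> l"
    and pow: "\<And>k. k \<in> K \<Longrightarrow> k [^] (n ^ e) \<in> L"
    and Z: "Z \<subseteq> carrier G" "\<forall>z\<in>Z. z [^] n \<in> M"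
      "\<forall>y\<in>Z. \<forall>z\<in>Z. \<exists>m\<in>M. y \<otimes> z = z \<otimes> y \<otimes> m"
    and split: "\<And>zs. set zs \<subseteq> Z \<Longrightarrow> length zs = N \<Longrightarrow>
      \<exists>as bs z cs. zs = as @ bs @ z # cs \<and> foldr (\<otimes>) bs \<one> \<otimes> z \<in> M"
    and zs: "set zs \<subseteq> Z" "length zs = e * N" and u: "u \<in> K"
  shows "fold (conj_norm G n) zs u \<in> L"
proof -
  interpret K: normal K G by fact
  interpret L: normal L G by fact
  define h where "h = (\<lambda>a. L #> a)"
  interpret V: group "G Mod L" by (rule L.factorgroup_is_group)
  interpret h: group_hom G "G Mod L" h
    unfolding h_def using L.r_coset_hom_Mod by unfold_locales
  have h1: "h l = \<one>\<^bsub>G Mod L\<^esub>" if "l \<in> L" for l using that by (simp add: h_def L.rcos_const)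
  have h1D: "l \<in> L" if "h l = \<one>\<^bsub>G Mod L\<^esub>" "l \<in> carrier G" for l
    using that rcos_self[OF that(2) L.subgroup_axioms] by (simp add: h_def)
  have surj: "\<exists>a\<in>carrier G. x = h a" if "x \<in> carrier (G Mod L)" for x
    using that by (auto simp: carrier_FactGroup h_def)
  interpret central_layer "h ` K" "G Mod L" "h ` M"
  proof (intro central_layer.intro central_layer_axioms.intro)
    show "h ` K \<lhd> G Mod L"
    proof (rule V.normal_invI)
      show "subgroup (h ` K) (G Mod L)" by (rule h.subgroup_img_is_subgroup) (rule K.subgroup_axioms)
      fix x k assume "x \<in> carrier (G Mod L)" "k \<in> h ` K"
      then obtain a k' where "a \<in> carrier G" "x = h a" "k' \<in> K" "k = h k'" using surj by blast
      then have "x \<otimes>\<^bsub>G Mod L\<^esub> k \<otimes>\<^bsub>G Mod L\<^esub> inv\<^bsub>G Mod L\<^esub> x = h (a \<otimes> k' \<otimes> inv a)"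
        "a \<otimes> k' \<otimes> inv a \<in> K"
        by (simp_all del: mult_FactGroup add: K.mem_carrier K.inv_op_closed2)
      then show "x \<otimes>\<^bsub>G Mod L\<^esub> k \<otimes>\<^bsub>G Mod L\<^esub> inv\<^bsub>G Mod L\<^esub> x \<in> h ` K" by simp
    qed
    show "subgroup (h ` M) (G Mod L)" using M(1) by (rule h.subgroup_img_is_subgroup)
    show "h ` K \<subseteq> h ` M" using M(2) by blast
    fix m k assume "m \<in> h ` M" "k \<in> h ` K"
    then obtain m' k' where mk: "m' \<in> M" "m = h m'" "k' \<in> K" "k = h k'" by blast
    then obtain l where l: "l \<in> L" "m' \<otimes> k' = k' \<otimes> m' \<otimes> l" using comm by blast
    have c: "m' \<in> carrier G" "k' \<in> carrier G" "l \<in> carrier G"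
      using mk l M(1) by (auto simp: subgroup.mem_carrier K.mem_carrier L.mem_carrier)
    then have "h (m' \<otimes> k') = h (k' \<otimes> m') \<otimes>\<^bsub>G Mod L\<^esub> h l" by (simp add: l(2) del: mult_FactGroup)
    then show "m \<otimes>\<^bsub>G Mod L\<^esub> k = k \<otimes>\<^bsub>G Mod L\<^esub> m"
      using c mk h1[OF l(1)] by (simp del: mult_FactGroup one_FactGroup)
  qed
  have "\<exists>v\<in>h ` K. fold (conj_norm (G Mod L) n) (map h zs) (h u) = v [^]\<^bsub>G Mod L\<^esub> (n ^ e)"
  proof (rule blocks_give_power[where Z = "h ` Z" and N = N])
    show "h ` Z \<subseteq> carrier (G Mod L)" using Z(1) by auto
    show "\<forall>z\<in>h ` Z. z [^]\<^bsub>G Mod L\<^esub> n \<in> h ` M"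
      using Z(1,2) by (auto simp flip: h.hom_nat_pow)
    show "\<forall>y\<in>h ` Z. \<forall>z\<in>h ` Z. \<exists>m\<in>h ` M. y \<otimes>\<^bsub>G Mod L\<^esub> z = z \<otimes>\<^bsub>G Mod L\<^esub> y \<otimes>\<^bsub>G Mod L\<^esub> m"
    proof (intro ballI)
      fix y z assume "y \<in> h ` Z" "z \<in> h ` Z"
      then obtain y' z' where yz: "y' \<in> Z" "y = h y'" "z' \<in> Z" "z = h z'" by blast
      then obtain m where m: "m \<in> M" "y' \<otimes> z' = z' \<otimes> y' \<otimes> m" using Z(3) by blast
      have "y' \<in> carrier G" "z' \<in> carrier G" "m \<in> carrier G"
        using yz m Z(1) assms(4) by (auto simp: subgroup.mem_carrier)
      then have "h (z' \<otimes> y' \<otimes> m) = z \<otimes>\<^bsub>G Mod L\<^esub> y \<otimes>\<^bsub>G Mod L\<^esub> h m"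
        "h (y' \<otimes> z') = y \<otimes>\<^bsub>G Mod L\<^esub> z"
        by (simp_all add: yz del: mult_FactGroup)
      then have "y \<otimes>\<^bsub>G Mod L\<^esub> z = z \<otimes>\<^bsub>G Mod L\<^esub> y \<otimes>\<^bsub>G Mod L\<^esub> h m" using m(2) by simp
      then show "\<exists>m\<in>h ` M. y \<otimes>\<^bsub>G Mod L\<^esub> z = z \<otimes>\<^bsub>G Mod L\<^esub> y \<otimes>\<^bsub>G Mod L\<^esub> m" using m(1) by blast
    qed
    show "set (map h zs) \<subseteq> h ` Z" "length (map h zs) = e * N" "h u \<in> h ` K" using zs u by auto
    fix ws assume ws: "set ws \<subseteq> h ` Z" "length ws = N"
    then have "ws \<in> map h ` lists Z" by (simp flip: lists_image) (simp add: lists_eq_set)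
    then obtain zs where zs: "ws = map h zs" "set zs \<subseteq> Z" by (auto simp: lists_eq_set)
    then obtain as bs z cs where s: "zs = as @ bs @ z # cs" "foldr (\<otimes>) bs \<one> \<otimes> z \<in> M"
      using split[of zs] ws by auto
    have "set bs \<subseteq> carrier G" "z \<in> carrier G" using s(1) zs(2) Z(1) by auto
    then have "foldr (\<otimes>\<^bsub>G Mod L\<^esub>) (map h bs) \<one>\<^bsub>G Mod L\<^esub> \<otimes>\<^bsub>G Mod L\<^esub> h z = h (foldr (\<otimes>) bs \<one> \<otimes> z)"
      by (simp add: h.hom_foldr_mult foldr_mult_closed del: mult_FactGroup one_FactGroup)
    then show "\<exists>as bs z cs. ws = as @ bs @ z # cs \<and>
        foldr (\<otimes>\<^bsub>G Mod L\<^esub>) bs \<one>\<^bsub>G Mod L\<^esub> \<otimes>\<^bsub>G Mod L\<^esub> z \<in> h ` M"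
      using s zs(1) by (intro exI[of _ "map h as"] exI[of _ "map h bs"] exI[of _ "h z"] exI[of _ "map h cs"]) simp
  qed
  then obtain v where v: "v \<in> K"
    "fold (conj_norm (G Mod L) n) (map h zs) (h u) = h v [^]\<^bsub>G Mod L\<^esub> (n ^ e)" by blast
  have c: "set zs \<subseteq> carrier G" "u \<in> carrier G" "v \<in> carrier G"
    using zs(1) Z(1) u v(1) by auto
  have "h (fold (conj_norm G n) zs u) = h (v [^] (n ^ e))"
    using v(2) c by (simp add: h.hom_fold_conj_norm h.hom_nat_pow)
  also have "\<dots> = \<one>\<^bsub>G Mod L\<^esub>" by (rule h1[OF pow[OF v(1)]])
  finally show ?thesis using c by (intro h1D fold_conj_norm_closed)
qed

section \<open>The lower central series\<close>

context group
begin

lemma normal_lower_central: "lower_central G i \<lhd> G"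
proof (induction i)
  case 0
  show ?case by (simp add: normal_self)
next
  case (Suc i)
  interpret S: normal "lower_central G i" G by fact
  show ?case
    unfolding lower_central.simps
  proof (rule normal_generateI)
    fix h g
    assume "h \<in> {x \<otimes> y \<otimes> inv x \<otimes> inv y | x y. x \<in> lower_central G i \<and> y \<in> carrier G}"
      and g: "g \<in> carrier G"
    then obtain x y where h: "h = x \<otimes> y \<otimes> inv x \<otimes> inv y" and x: "x \<in> lower_central G i"
      and y: "y \<in> carrier G" by blast
    have xc: "x \<in> carrier G" using x by (rule S.mem_carrier)
    have cancel: "inv g \<otimes> (g \<otimes> z) = z" if "z \<in> carrier G" for z
      using g that by (simp flip: m_assoc)
    have "g \<otimes> h \<otimes> inv g = (g \<otimes> x \<otimes> inv g) \<otimes> (g \<otimes> y \<otimes> inv g) \<otimes>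
        inv (g \<otimes> x \<otimes> inv g) \<otimes> inv (g \<otimes> y \<otimes> inv g)"
      using g xc y by (simp add: h m_assoc inv_mult_group cancel)
    then show "g \<otimes> h \<otimes> inv g \<in>
        {x \<otimes> y \<otimes> inv x \<otimes> inv y | x y. x \<in> lower_central G i \<and> y \<in> carrier G}"
      using S.inv_op_closed2[OF g x] g y by blast
  qed (auto intro: S.mem_carrier)
qed

lemma lower_central_carrier: "x \<in> lower_central G i \<Longrightarrow> x \<in> carrier G"
  using normal_lower_central[of i] by (meson normal_imp_subgroup subgroup.mem_carrier)

lemma lower_central_Suc_subset: "lower_central G (Suc i) \<subseteq> lower_central G i"
proof -
  interpret S: normal "lower_central G i" G by (rule normal_lower_central)
  have "x \<otimes> y \<otimes> inv x \<otimes> inv y \<in> lower_central G i"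
    if x: "x \<in> lower_central G i" and y: "y \<in> carrier G" for x y
  proof -
    have "x \<otimes> (y \<otimes> inv x \<otimes> inv y) \<in> lower_central G i"
      using x y by (intro S.m_closed S.inv_op_closed2) auto
    then show ?thesis using x y S.mem_carrier[OF x] by (simp add: m_assoc)
  qed
  then show ?thesis
    unfolding lower_central.simps by (intro generate_subgroup_incl S.subgroup_axioms) blast
qed

lemma lower_central_commute:
  assumes x: "x \<in> lower_central G i" and y: "y \<in> carrier G"
  shows "\<exists>l \<in> lower_central G (Suc i). y \<otimes> x = x \<otimes> y \<otimes> l"
proof
  let ?c = "inv x \<otimes> inv y \<otimes> inv (inv x) \<otimes> inv (inv y)"
  have xc: "x \<in> carrier G" using x by (rule lower_central_carrier)
  then have inv_c: "inv ?c = inv (x \<otimes> y) \<otimes> (y \<otimes> x)"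
    using y by (simp add: inv_mult_group m_assoc)
  have "w \<otimes> (inv w \<otimes> z) = z" if "w \<in> carrier G" "z \<in> carrier G" for w z
    using that by (simp flip: m_assoc)
  from this[OF m_closed[OF xc y] m_closed[OF y xc]]
  show "y \<otimes> x = x \<otimes> y \<otimes> (inv (x \<otimes> y) \<otimes> (y \<otimes> x))"
    by (rule sym)
  have "inv x \<in> lower_central G i" "inv y \<in> carrier G"
    using x y normal_imp_subgroup[OF normal_lower_central] by (auto simp: subgroup.m_inv_closed)
  then have "?c \<in> lower_central G (Suc i)"
    unfolding lower_central.simps by (intro generate.incl) blast
  then have "inv ?c \<in> lower_central G (Suc i)"
    by (rule subgroup.m_inv_closed[OF normal_imp_subgroup[OF normal_lower_central]])
  then show "inv (x \<otimes> y) \<otimes> (y \<otimes> x) \<in> lower_central G (Suc i)"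
    unfolding inv_c .
qed

text \<open>Two of the \<open>card D + 1\<close> products of initial segments coincide.\<close>

lemma segment_with_trivial_product:
  assumes D: "subgroup D G" "finite D" and ds: "set ds \<subseteq> D" "length ds = card D"
  shows "\<exists>as bs z cs. ds = as @ bs @ z # cs \<and> foldr (\<otimes>) bs \<one> \<otimes> z = \<one>"
proof -
  let ?P = "\<lambda>k. foldr (\<otimes>) (take k ds) \<one>"
  interpret D: subgroup D G by fact
  have PD: "foldr (\<otimes>) xs \<one> \<in> D" if "set xs \<subseteq> D" for xs using that by (induction xs) auto
  have "?P ` {..card D} \<subseteq> D"
    using ds(1) by (auto intro!: PD dest: in_set_takeD)
  then have "card (?P ` {..card D}) \<le> card D" using D(2) by (rule card_mono[rotated])
  then have "\<not> inj_on ?P {..card D}" using pigeonhole[of ?P "{..card D}"] by simp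
  then obtain i j where ij: "i < j" "j \<le> card D" "?P i = ?P j"
    unfolding inj_on_def by (metis atMost_iff linorder_neqE_nat)
  define mid where "mid = drop i (take j ds)"
  have take_j: "take j ds = take i ds @ mid"
    unfolding mid_def using ij(1) by (metis append_take_drop_id min.absorb1 less_imp_le take_take)
  have "mid \<noteq> []" using ij ds(2) by (simp add: mid_def)
  then have mid: "mid = butlast mid @ [last mid]" by simp
  have sub: "set (take i ds) \<subseteq> carrier G" "set mid \<subseteq> carrier G"
    using ds(1) D.subset by (auto simp: mid_def dest!: in_set_takeD in_set_dropD)
  have "?P i \<otimes> foldr (\<otimes>) mid \<one> = ?P i"
    using ij(3) sub foldr_mult_append by (simp add: take_j)
  then have "foldr (\<otimes>) mid \<one> = \<one>" using sub by (simp add: foldr_mult_closed)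
  moreover have "set (butlast mid) \<subseteq> carrier G" "last mid \<in> carrier G"
    using sub(2) \<open>mid \<noteq> []\<close> in_set_butlastD last_in_set by fast+
  ultimately have "foldr (\<otimes>) (butlast mid) \<one> \<otimes> last mid = \<one>"
    using mid foldr_mult_append[of "butlast mid" "[last mid]"] by simp
  moreover have "ds = take i ds @ butlast mid @ last mid # drop j ds"
    by (metis append_assoc append_Cons append_Nil append_take_drop_id mid take_j)
  ultimately show ?thesis by blast
qed

end

section \<open>The norm laws\<close>

definition norm_word :: "nat \<Rightarrow> word \<Rightarrow> word \<Rightarrow> word" where
  "norm_word n z u = power_word (u @ z) n @ inv_word (power_word z n)"

text \<open>The variable \<open>0\<close> provides an element of the base group through its \<open>p * q\<close>-th power, the variables
  \<open>1, \<dots>, m\<close> provide through their \<open>q\<close>-th powers the elements along which norms are taken.\<close>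

definition norm_law :: "nat \<Rightarrow> nat \<Rightarrow> nat \<Rightarrow> word" where
  "norm_law p q m =
     fold (\<lambda>k. norm_word p (power_word [(k, True)] q)) [1..<Suc m] (power_word [(0, True)] (p * q))"

lemma (in group) eval_norm_law:
  assumes s: "s \<in> UNIV \<rightarrow> carrier G"
  shows "eval_word G s (norm_law p q m) =
    fold (conj_norm G p) (map (\<lambda>k. s k [^] q) [1..<Suc m]) (s 0 [^] (p * q))"
proof -
  have si: "s i \<in> carrier G" for i using s by auto
  have "eval_word G s (fold (\<lambda>k. norm_word p (power_word [(k, True)] q)) ks u) =
      fold (conj_norm G p) (map (\<lambda>k. s k [^] q) ks) (eval_word G s u)" for ks u
    using s si
    by (induction ks arbitrary: u)
      (simp_all add: norm_word_def conj_norm_def eval_word_append eval_word_inv eval_word_power)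
  then show ?thesis using s si by (simp add: norm_law_def eval_word_power)
qed

text \<open>The normal subgroups \<open>S\<^sup>B\<close> of the wreath product for \<open>S\<close> normal in \<open>A\<close>. With the lower central
  series of \<open>A\<close> for \<open>S\<close> they form a central series of the base group.\<close>

definition base_layer :: "('b, 'n) monoid_scheme \<Rightarrow> 'a set \<Rightarrow> (('b \<Rightarrow> 'a) \<times> 'b) set" where
  "base_layer B S = (carrier B \<rightarrow>\<^sub>E S) \<times> {\<one>\<^bsub>B\<^esub>}"

context
  fixes A :: "('a, 'm) monoid_scheme" and B :: "('b, 'n) monoid_scheme"
  assumes A: "group A" and B: "group B"
begin

interpretation A: group A by (rule A)
interpretation B: group B by (rule B)
interpretation W: group "A Wr B" by (rule group_wreath_product[OF A B])

lemma inv_base: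
  "f \<in> carrier B \<rightarrow>\<^sub>E carrier A \<Longrightarrow>
    inv\<^bsub>A Wr B\<^esub> (f, \<one>\<^bsub>B\<^esub>) = ((\<lambda>x\<in>carrier B. inv\<^bsub>A\<^esub> (f x)), \<one>\<^bsub>B\<^esub>)"
  using inv_wreath[OF A B, of f "\<one>\<^bsub>B\<^esub>"] by (simp add: carrier_wreath cong: restrict_cong)

lemma normal_base_layer:
  assumes "S \<lhd> A"
  shows "base_layer B S \<lhd> A Wr B"
proof (rule W.normal_invI)
  interpret S: normal S A by fact
  have S [simp]: "x \<in> S \<Longrightarrow> x \<in> carrier A" for x by (rule S.mem_carrier)
  show "subgroup (base_layer B S) (A Wr B)"
  proof
    show "base_layer B S \<subseteq> carrier (A Wr B)" by (auto simp: base_layer_def carrier_wreath PiE_iff)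
    show "\<one>\<^bsub>A Wr B\<^esub> \<in> base_layer B S" by (auto simp: base_layer_def one_wreath)
    fix x assume x: "x \<in> base_layer B S"
    then show "inv\<^bsub>A Wr B\<^esub> x \<in> base_layer B S"
      by (auto simp: base_layer_def inv_base PiE_iff)
    fix y assume "y \<in> base_layer B S"
    with x show "x \<otimes>\<^bsub>A Wr B\<^esub> y \<in> base_layer B S"
      by (auto simp: base_layer_def PiE_iff)
  qed
  fix w x assume "w \<in> carrier (A Wr B)" "x \<in> base_layer B S"
  moreover obtain g b where "w = (g, b)" by (cases w)
  moreover obtain f where "x = (f, \<one>\<^bsub>B\<^esub>)" "f \<in> carrier B \<rightarrow>\<^sub>E S"
    using calculation by (auto simp: base_layer_def)
  ultimately have w: "w = (g, b)" "(g, b) \<in> carrier (A Wr B)" and x: "x = (f, \<one>\<^bsub>B\<^esub>)"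
    and f: "f \<in> carrier B \<rightarrow>\<^sub>E S" by auto
  have "w \<otimes>\<^bsub>A Wr B\<^esub> x \<otimes>\<^bsub>A Wr B\<^esub> inv\<^bsub>A Wr B\<^esub> w =
      ((\<lambda>c\<in>carrier B. g c \<otimes>\<^bsub>A\<^esub> f (c \<otimes>\<^bsub>B\<^esub> b) \<otimes>\<^bsub>A\<^esub> inv\<^bsub>A\<^esub> (g c)), \<one>\<^bsub>B\<^esub>)"
    using w(2) by (auto simp: w(1) x inv_wreath[OF A B w(2)] carrier_wreath B.m_assoc cong: restrict_cong)
  moreover have "g c \<otimes>\<^bsub>A\<^esub> f (c \<otimes>\<^bsub>B\<^esub> b) \<otimes>\<^bsub>A\<^esub> inv\<^bsub>A\<^esub> (g c) \<in> S" if "c \<in> carrier B" for c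
    using that w(2) f by (intro S.inv_op_closed2) (auto simp: carrier_wreath)
  ultimately show "w \<otimes>\<^bsub>A Wr B\<^esub> x \<otimes>\<^bsub>A Wr B\<^esub> inv\<^bsub>A Wr B\<^esub> w \<in> base_layer B S"
    by (auto simp: base_layer_def)
qed

lemma base_iff: "x \<in> carrier (A Wr B) \<Longrightarrow> x \<in> base_layer B (carrier A) \<longleftrightarrow> snd x = \<one>\<^bsub>B\<^esub>"
  by (auto simp: base_layer_def carrier_wreath)

lemma group_hom_snd: "group_hom (A Wr B) B snd"
  by unfold_locales (auto simp: hom_def carrier_wreath)

lemma base_pow:
  assumes "f \<in> carrier B \<rightarrow>\<^sub>E carrier A"
  shows "(f, \<one>\<^bsub>B\<^esub>) [^]\<^bsub>A Wr B\<^esub> (k::nat) = ((\<lambda>x\<in>carrier B. f x [^]\<^bsub>A\<^esub> k), \<one>\<^bsub>B\<^esub>)"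
proof (induction k)
  case (Suc k)
  then show ?case using assms by (auto simp: restrict_def)
qed (auto simp: one_wreath)

lemma base_layers_commute:
  assumes m: "m \<in> base_layer B (carrier A)" and k: "k \<in> base_layer B (lower_central A i)"
  shows "\<exists>l \<in> base_layer B (lower_central A (Suc i)).
    m \<otimes>\<^bsub>A Wr B\<^esub> k = k \<otimes>\<^bsub>A Wr B\<^esub> m \<otimes>\<^bsub>A Wr B\<^esub> l"
proof -
  obtain f g where m: "m = (g, \<one>\<^bsub>B\<^esub>)" "g \<in> carrier B \<rightarrow>\<^sub>E carrier A"
    and k: "k = (f, \<one>\<^bsub>B\<^esub>)" "f \<in> carrier B \<rightarrow>\<^sub>E lower_central A i"
    using m k by (auto simp: base_layer_def)
  have "\<forall>x\<in>carrier B. \<exists>l \<in> lower_central A (Suc i). g x \<otimes>\<^bsub>A\<^esub> f x = f x \<otimes>\<^bsub>A\<^esub> g x \<otimes>\<^bsub>A\<^esub> l"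
    using m(2) k(2) by (intro ballI A.lower_central_commute) auto
  then obtain l where l: "\<And>x. x \<in> carrier B \<Longrightarrow> l x \<in> lower_central A (Suc i)"
    "\<And>x. x \<in> carrier B \<Longrightarrow> g x \<otimes>\<^bsub>A\<^esub> f x = f x \<otimes>\<^bsub>A\<^esub> g x \<otimes>\<^bsub>A\<^esub> l x"
    by metis
  show ?thesis
  proof
    show "(\<lambda>x\<in>carrier B. l x, \<one>\<^bsub>B\<^esub>) \<in> base_layer B (lower_central A (Suc i))"
      using l(1) unfolding base_layer_def by (auto simp del: lower_central.simps)
    show "m \<otimes>\<^bsub>A Wr B\<^esub> k = k \<otimes>\<^bsub>A Wr B\<^esub> m \<otimes>\<^bsub>A Wr B\<^esub> (\<lambda>x\<in>carrier B. l x, \<one>\<^bsub>B\<^esub>)"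
      using l(2) by (simp add: m(1) k(1) cong: restrict_cong)
  qed
qed

end

text \<open>The number \<open>m\<close> of norms is \<open>c * (e * card D)\<close>: there are \<open>c\<close> factors of the lower central series of
  \<open>A\<close>, each of them takes \<open>e\<close> blocks because \<open>p ^ e\<close> annihilates it, and a block has length \<open>card D\<close>
  so that it contains a segment with product in the base group.\<close>

lemma norm_law_holds:
  fixes A :: "('a, 'm) monoid_scheme" and B :: "('b, 'n) monoid_scheme"
  assumes A: "nilpotent_group A" and pe: "\<And>x. x \<in> carrier A \<Longrightarrow> x [^]\<^bsub>A\<^esub> (p ^ e) = \<one>\<^bsub>A\<^esub>"
    and B: "comm_group B" and pq: "\<And>b. b \<in> carrier B \<Longrightarrow> b [^]\<^bsub>B\<^esub> (p * q) = \<one>\<^bsub>B\<^esub>"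
    and fin: "finite ((\<lambda>b. b [^]\<^bsub>B\<^esub> q) ` carrier B)"
  shows "\<exists>m. satisfies (A Wr B) {norm_law p q m}"
proof -
  define D where "D = (\<lambda>b. b [^]\<^bsub>B\<^esub> q) ` carrier B"
  interpret A: group A using A by (simp add: nilpotent_group_def)
  interpret B: comm_group B by fact
  interpret W: group "A Wr B" by (rule group_wreath_product[OF A.is_group B.is_group])
  interpret snd: group_hom "A Wr B" B snd by (rule group_hom_snd[OF A.is_group B.is_group])
  interpret q: group_hom B B "\<lambda>b. b [^]\<^bsub>B\<^esub> q"
    by unfold_locales (auto simp: hom_def B.nat_pow_distrib)
  have D: "subgroup D B" unfolding D_def by (rule q.img_is_subgroup)
  obtain c where c: "lower_central A c = {\<one>\<^bsub>A\<^esub>}" using A by (auto simp: nilpotent_group_def)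
  define Z where "Z = (\<lambda>y. y [^]\<^bsub>A Wr B\<^esub> q) ` carrier (A Wr B)"
  define M where "M = base_layer B (carrier A)"
  note base_iff = base_iff[OF A.is_group B.is_group, folded M_def]
  have Zc: "Z \<subseteq> carrier (A Wr B)" by (auto simp: Z_def)
  have snd_c: "snd x \<in> carrier B" if "x \<in> carrier (A Wr B)" for x using snd.hom_closed that by blast
  have Zp: "\<forall>z\<in>Z. z [^]\<^bsub>A Wr B\<^esub> p \<in> M"
    using pq snd_c
    by (auto simp: Z_def base_iff W.nat_pow_pow snd.hom_nat_pow mult.commute[of q])
  have Zcomm: "\<forall>y\<in>Z. \<forall>z\<in>Z. \<exists>m\<in>M. y \<otimes>\<^bsub>A Wr B\<^esub> z = z \<otimes>\<^bsub>A Wr B\<^esub> y \<otimes>\<^bsub>A Wr B\<^esub> m"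
  proof (intro ballI)
    fix y z assume "y \<in> Z" "z \<in> Z"
    then have yz: "y \<in> carrier (A Wr B)" "z \<in> carrier (A Wr B)" using Zc by auto
    let ?m = "inv\<^bsub>A Wr B\<^esub> (z \<otimes>\<^bsub>A Wr B\<^esub> y) \<otimes>\<^bsub>A Wr B\<^esub> (y \<otimes>\<^bsub>A Wr B\<^esub> z)"
    have "snd ?m = \<one>\<^bsub>B\<^esub>" using yz snd_c by (simp add: snd.hom_mult B.m_comm[of "snd y"])
    then have "?m \<in> M" using yz by (simp add: base_iff)
    moreover have "y \<otimes>\<^bsub>A Wr B\<^esub> z = z \<otimes>\<^bsub>A Wr B\<^esub> y \<otimes>\<^bsub>A Wr B\<^esub> ?m"
      using yz by (simp flip: W.m_assoc)
    ultimately show "\<exists>m\<in>M. y \<otimes>\<^bsub>A Wr B\<^esub> z = z \<otimes>\<^bsub>A Wr B\<^esub> y \<otimes>\<^bsub>A Wr B\<^esub> m" by blast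
  qed
  have split: "\<exists>as bs z cs. zs = as @ bs @ z # cs \<and>
      foldr (\<otimes>\<^bsub>A Wr B\<^esub>) bs \<one>\<^bsub>A Wr B\<^esub> \<otimes>\<^bsub>A Wr B\<^esub> z \<in> M"
    if zs: "set zs \<subseteq> Z" "length zs = card D" for zs
  proof -
    have "snd z \<in> D" if "z \<in> Z" for z
    proof -
      from that obtain y where y: "y \<in> carrier (A Wr B)" "z = y [^]\<^bsub>A Wr B\<^esub> q"
        unfolding Z_def by blast
      then have "snd z = snd y [^]\<^bsub>B\<^esub> q" by (simp add: snd.hom_nat_pow)
      then show ?thesis unfolding D_def using snd_c[OF y(1)] by blast
    qed
    then have "set (map snd zs) \<subseteq> D" using zs(1) by auto
    then obtain as' bs' z' cs' where s: "map snd zs = as' @ bs' @ z' # cs'"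
      "foldr (\<otimes>\<^bsub>B\<^esub>) bs' \<one>\<^bsub>B\<^esub> \<otimes>\<^bsub>B\<^esub> z' = \<one>\<^bsub>B\<^esub>"
      using B.segment_with_trivial_product[OF D, of "map snd zs"] fin zs(2) by (auto simp: D_def)
    obtain as vs where "zs = as @ vs" "map snd vs = bs' @ z' # cs'"
      using s(1) by (metis map_eq_append_conv)
    moreover then obtain bs ws where "vs = bs @ ws" "bs' = map snd bs" "map snd ws = z' # cs'"
      by (metis map_eq_append_conv)
    moreover then obtain z cs where "ws = z # cs" "z' = snd z" by auto
    ultimately have zs': "zs = as @ bs @ z # cs" "bs' = map snd bs" "z' = snd z" by simp_all
    then have "set bs \<subseteq> carrier (A Wr B)" "z \<in> carrier (A Wr B)" using zs(1) Zc by auto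
    then have "foldr (\<otimes>\<^bsub>A Wr B\<^esub>) bs \<one>\<^bsub>A Wr B\<^esub> \<otimes>\<^bsub>A Wr B\<^esub> z \<in> M"
      using s(2) by (simp add: base_iff W.foldr_mult_closed snd.hom_foldr_mult snd.hom_mult zs')
    then show ?thesis using zs'(1) by blast
  qed
  have descend: "fold (conj_norm (A Wr B) p) zs u \<in> base_layer B (lower_central A i)"
    if "set zs \<subseteq> Z" "length zs = i * (e * card D)" "u \<in> M" for zs u i
    using that(1,2)
  proof (induction i arbitrary: zs)
    case 0
    then show ?case using that(3) by (simp add: M_def)
  next
    case (Suc i)
    let ?k = "i * (e * card D)"
    have t: "set (take ?k zs) \<subseteq> Z" "length (take ?k zs) = ?k"
      "set (drop ?k zs) \<subseteq> Z" "length (drop ?k zs) = e * card D"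
      using Suc.prems by (auto dest: in_set_takeD in_set_dropD)
    have "fold (conj_norm (A Wr B) p) (drop ?k zs) (fold (conj_norm (A Wr B) p) (take ?k zs) u)
        \<in> base_layer B (lower_central A (Suc i))"
    proof (rule W.norms_descend[where M = M and Z = Z and N = "card D"])
      show "base_layer B (lower_central A i) \<lhd> A Wr B"
        "base_layer B (lower_central A (Suc i)) \<lhd> A Wr B"
        by (intro normal_base_layer A.normal_lower_central A.is_group B.is_group)+
      show "base_layer B (lower_central A (Suc i)) \<subseteq> base_layer B (lower_central A i)"
        using A.lower_central_Suc_subset[of i] unfolding base_layer_def
        by (intro Sigma_mono PiE_mono) auto
      show "subgroup M (A Wr B)"
        unfolding M_def by (intro normal_imp_subgroup normal_base_layer A.normal_self A.is_group B.is_group)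
      show "base_layer B (lower_central A i) \<subseteq> M"
        unfolding M_def base_layer_def
        by (intro Sigma_mono PiE_mono subsetI A.lower_central_carrier[of _ i]) auto
      show "\<exists>l\<in>base_layer B (lower_central A (Suc i)).
          m \<otimes>\<^bsub>A Wr B\<^esub> k = k \<otimes>\<^bsub>A Wr B\<^esub> m \<otimes>\<^bsub>A Wr B\<^esub> l"
        if "m \<in> M" "k \<in> base_layer B (lower_central A i)" for m k
        using base_layers_commute[OF A.is_group B.is_group] that by (simp add: M_def)
      show "k [^]\<^bsub>A Wr B\<^esub> (p ^ e) \<in> base_layer B (lower_central A (Suc i))"
        if k: "k \<in> base_layer B (lower_central A i)" for k
      proof -
        interpret L: normal "lower_central A (Suc i)" A by (rule A.normal_lower_central)
        obtain f where f: "k = (f, \<one>\<^bsub>B\<^esub>)" "f \<in> carrier B \<rightarrow>\<^sub>E lower_central A i"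
          using k by (auto simp: base_layer_def)
        then have "f \<in> carrier B \<rightarrow>\<^sub>E carrier A" using A.lower_central_carrier by blast
        then have "k [^]\<^bsub>A Wr B\<^esub> (p ^ e) = (\<lambda>x\<in>carrier B. \<one>\<^bsub>A\<^esub>, \<one>\<^bsub>B\<^esub>)"
          by (auto simp: f(1) base_pow[OF A.is_group B.is_group] intro!: restrict_ext pe)
        then show ?thesis unfolding base_layer_def using L.one_closed by auto
      qed
      show "fold (conj_norm (A Wr B) p) (take ?k zs) u \<in> base_layer B (lower_central A i)"
        by (rule Suc.IH[OF t(1,2)])
    qed (use Zc Zp Zcomm split t in auto)
    then show ?case by (metis append_take_drop_id comp_apply fold_append)
  qed
  have "satisfies (A Wr B) {norm_law p q (c * (e * card D))}"
    unfolding satisfies_singleton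
  proof
    fix s :: "nat \<Rightarrow> ('b \<Rightarrow> 'a) \<times> 'b" assume s: "s \<in> UNIV \<rightarrow> carrier (A Wr B)"
    have si: "s i \<in> carrier (A Wr B)" for i using s by auto
    have "s 0 [^]\<^bsub>A Wr B\<^esub> (p * q) \<in> M"
      using si[of 0] pq snd_c by (simp add: base_iff snd.hom_nat_pow)
    then have "eval_word (A Wr B) s (norm_law p q (c * (e * card D))) \<in> base_layer B (lower_central A c)"
      unfolding W.eval_norm_law[OF s] using si by (intro descend) (auto simp: Z_def)
    then show "eval_word (A Wr B) s (norm_law p q (c * (e * card D))) = \<one>\<^bsub>A Wr B\<^esub>"
      by (auto simp: c base_layer_def one_wreath PiE_iff extensional_def fun_eq_iff)
  qed
  then show ?thesis by blast
qed

section \<open>The norm laws fail in large wreath products\<close>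

text \<open>The norm along \<open>d\<close> is the product of the translates of \<open>f\<close> by \<open>d [^] k\<close>. Its value at the identity
  comes from \<open>f\<close> alone if \<open>f\<close> is trivial at the other points \<open>d [^] k\<close>.\<close>

lemma conj_norm_spread:
  fixes A :: "('a, 'm) monoid_scheme" and B :: "('b, 'n) monoid_scheme"
  assumes A: "group A" and B: "group B" and d: "d \<in> carrier B"
    and f: "f \<in> carrier B \<rightarrow>\<^sub>E carrier A" and n: "n > 0"
    and sparse: "\<And>k. 0 < k \<Longrightarrow> k < n \<Longrightarrow> f (d [^]\<^bsub>B\<^esub> k) = \<one>\<^bsub>A\<^esub>"
  obtains F where "F \<in> carrier B \<rightarrow>\<^sub>E carrier A"
    and "conj_norm (A Wr B) n (\<lambda>x\<in>carrier B. \<one>\<^bsub>A\<^esub>, d) (f, \<one>\<^bsub>B\<^esub>) = (F, \<one>\<^bsub>B\<^esub>)"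
    and "F \<one>\<^bsub>B\<^esub> = f \<one>\<^bsub>B\<^esub>"
    and "\<And>x. x \<in> carrier B \<Longrightarrow> F x \<noteq> \<one>\<^bsub>A\<^esub> \<Longrightarrow> \<exists>k<n. f (x \<otimes>\<^bsub>B\<^esub> d [^]\<^bsub>B\<^esub> k) \<noteq> \<one>\<^bsub>A\<^esub>"
proof -
  interpret A: group A by fact
  interpret B: group B by fact
  interpret W: group "A Wr B" by (rule group_wreath_product[OF A B])
  define z where "z = (\<lambda>x\<in>carrier B. \<one>\<^bsub>A\<^esub>, d)"
  have z: "z \<in> carrier (A Wr B)" using d by (auto simp: z_def carrier_wreath)
  have inv_z: "inv\<^bsub>A Wr B\<^esub> z = (\<lambda>x\<in>carrier B. \<one>\<^bsub>A\<^esub>, inv\<^bsub>B\<^esub> d)"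
    using d z unfolding z_def by (subst inv_wreath[OF A B]) (auto simp: restrict_def)
  have u: "(f, \<one>\<^bsub>B\<^esub>) \<in> carrier (A Wr B)" using f by (simp add: carrier_wreath)
  have step: "conj_norm (A Wr B) (Suc n) z (f, \<one>\<^bsub>B\<^esub>) =
      ((\<lambda>x\<in>carrier B. f x \<otimes>\<^bsub>A\<^esub> F (x \<otimes>\<^bsub>B\<^esub> d)), \<one>\<^bsub>B\<^esub>)"
    if F: "F \<in> carrier B \<rightarrow>\<^sub>E carrier A" "conj_norm (A Wr B) n z (f, \<one>\<^bsub>B\<^esub>) = (F, \<one>\<^bsub>B\<^esub>)" for n F
  proof -
    have "F (x \<otimes>\<^bsub>B\<^esub> d) \<in> carrier A" "f x \<in> carrier A" if "x \<in> carrier B" for x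
      using that F d f by auto
    then show ?thesis
      using d unfolding W.conj_norm_Suc[OF z u] F(2) inv_z
      by (auto simp: z_def restrict_def)
  qed
  have spread: "\<exists>F. F \<in> carrier B \<rightarrow>\<^sub>E carrier A \<and> conj_norm (A Wr B) n z (f, \<one>\<^bsub>B\<^esub>) = (F, \<one>\<^bsub>B\<^esub>) \<and>
      (\<forall>x\<in>carrier B. F x \<noteq> \<one>\<^bsub>A\<^esub> \<longrightarrow> (\<exists>k<n. f (x \<otimes>\<^bsub>B\<^esub> d [^]\<^bsub>B\<^esub> k) \<noteq> \<one>\<^bsub>A\<^esub>))" for n
  proof (induction n)
    case 0
    show ?case by (rule exI[of _ "\<lambda>x\<in>carrier B. \<one>\<^bsub>A\<^esub>"]) (auto simp: one_wreath)
  next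
    case (Suc n)
    then obtain F where F: "F \<in> carrier B \<rightarrow>\<^sub>E carrier A"
      "conj_norm (A Wr B) n z (f, \<one>\<^bsub>B\<^esub>) = (F, \<one>\<^bsub>B\<^esub>)"
      "\<And>x. x \<in> carrier B \<Longrightarrow> F x \<noteq> \<one>\<^bsub>A\<^esub> \<Longrightarrow> \<exists>k<n. f (x \<otimes>\<^bsub>B\<^esub> d [^]\<^bsub>B\<^esub> k) \<noteq> \<one>\<^bsub>A\<^esub>"
      by blast
    have supp: "\<exists>k<Suc n. f (x \<otimes>\<^bsub>B\<^esub> d [^]\<^bsub>B\<^esub> k) \<noteq> \<one>\<^bsub>A\<^esub>"
      if x: "x \<in> carrier B" and ne: "f x \<otimes>\<^bsub>A\<^esub> F (x \<otimes>\<^bsub>B\<^esub> d) \<noteq> \<one>\<^bsub>A\<^esub>" for x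
    proof (cases "f x = \<one>\<^bsub>A\<^esub>")
      case True
      then have "F (x \<otimes>\<^bsub>B\<^esub> d) \<noteq> \<one>\<^bsub>A\<^esub>" using ne by auto
      then obtain k where "k < n" "f (x \<otimes>\<^bsub>B\<^esub> d \<otimes>\<^bsub>B\<^esub> d [^]\<^bsub>B\<^esub> k) \<noteq> \<one>\<^bsub>A\<^esub>"
        using F(3)[of "x \<otimes>\<^bsub>B\<^esub> d"] x d by auto
      moreover have "x \<otimes>\<^bsub>B\<^esub> d \<otimes>\<^bsub>B\<^esub> d [^]\<^bsub>B\<^esub> k = x \<otimes>\<^bsub>B\<^esub> d [^]\<^bsub>B\<^esub> Suc k"
        using x d B.nat_pow_Suc2[OF d, of k] by (simp only: B.m_assoc B.nat_pow_closed)
      ultimately show ?thesis by (metis Suc_mono)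
    next
      case False
      then show ?thesis using x by (intro exI[of _ 0]) simp
    qed
    have "(\<lambda>x\<in>carrier B. f x \<otimes>\<^bsub>A\<^esub> F (x \<otimes>\<^bsub>B\<^esub> d)) \<in> carrier B \<rightarrow>\<^sub>E carrier A"
      using F(1) f d by (auto simp: PiE_iff)
    with step[OF F(1,2)] supp show ?case by (intro exI[of _ "\<lambda>x\<in>carrier B. f x \<otimes>\<^bsub>A\<^esub> F (x \<otimes>\<^bsub>B\<^esub> d)"]) auto
  qed
  obtain m where m: "n = Suc m" using n by (cases n) auto
  obtain F where F: "F \<in> carrier B \<rightarrow>\<^sub>E carrier A" "conj_norm (A Wr B) n z (f, \<one>\<^bsub>B\<^esub>) = (F, \<one>\<^bsub>B\<^esub>)"
    "\<And>x. x \<in> carrier B \<Longrightarrow> F x \<noteq> \<one>\<^bsub>A\<^esub> \<Longrightarrow> \<exists>k<n. f (x \<otimes>\<^bsub>B\<^esub> d [^]\<^bsub>B\<^esub> k) \<noteq> \<one>\<^bsub>A\<^esub>"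
    using spread[of n] by blast
  obtain F' where F': "F' \<in> carrier B \<rightarrow>\<^sub>E carrier A" "conj_norm (A Wr B) m z (f, \<one>\<^bsub>B\<^esub>) = (F', \<one>\<^bsub>B\<^esub>)"
    "\<And>x. x \<in> carrier B \<Longrightarrow> F' x \<noteq> \<one>\<^bsub>A\<^esub> \<Longrightarrow> \<exists>k<m. f (x \<otimes>\<^bsub>B\<^esub> d [^]\<^bsub>B\<^esub> k) \<noteq> \<one>\<^bsub>A\<^esub>"
    using spread[of m] by blast
  have "F' d = \<one>\<^bsub>A\<^esub>"
  proof (rule ccontr)
    assume "F' d \<noteq> \<one>\<^bsub>A\<^esub>"
    then obtain k where k: "k < m" "f (d \<otimes>\<^bsub>B\<^esub> d [^]\<^bsub>B\<^esub> k) \<noteq> \<one>\<^bsub>A\<^esub>" using F'(3)[OF d] by blast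
    then show False using sparse[of "Suc k"] m B.nat_pow_Suc2[OF d, of k] by simp
  qed
  moreover have "F = (\<lambda>x\<in>carrier B. f x \<otimes>\<^bsub>A\<^esub> F' (x \<otimes>\<^bsub>B\<^esub> d))"
    using step[OF F'(1,2)] F(2) m by simp
  moreover have "f \<one>\<^bsub>B\<^esub> \<in> carrier A" using f by auto
  ultimately have "F \<one>\<^bsub>B\<^esub> = f \<one>\<^bsub>B\<^esub>" using d by simp
  with F show thesis using that by (simp add: z_def)
qed

definition supported_below :: "nat \<Rightarrow> ('a, 'm) monoid_scheme \<Rightarrow> nat \<Rightarrow> ((nat \<Rightarrow> int) \<Rightarrow> 'a) \<Rightarrow> bool" where
  "supported_below N A r f \<longleftrightarrow>
     (\<forall>x\<in>carrier (cyclic_sum N). f x \<noteq> \<one>\<^bsub>A\<^esub> \<longrightarrow> (\<forall>j\<ge>r. x j = 0))"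

text \<open>A function whose support has vanishing coordinates from \<open>r\<close> on is spread in the direction of
  coordinate \<open>r\<close>. The factorization \<open>N = n * t\<close> covers the two cases in the norm laws: the first
  step has \<open>n = N\<close> and \<open>t = 1\<close>, all others have \<open>n = p\<close> and \<open>t = q\<close>.\<close>

lemma conj_norm_unit_vector:
  fixes A :: "('a, 'm) monoid_scheme"
  assumes A: "group A" and N: "N = n * t" "n > 0" "t > 0" "N > 1"
    and f: "f \<in> carrier (cyclic_sum N) \<rightarrow>\<^sub>E carrier A" "supported_below N A r f"
  obtains F where "F \<in> carrier (cyclic_sum N) \<rightarrow>\<^sub>E carrier A" "supported_below N A (Suc r) F"
    and "conj_norm (A Wr cyclic_sum N) n
        (\<lambda>x\<in>carrier (cyclic_sum N). \<one>\<^bsub>A\<^esub>, unit_vector N r [^]\<^bsub>cyclic_sum N\<^esub> t) (f, \<lambda>_. 0) = (F, \<lambda>_. 0)"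
    and "F (\<lambda>_. 0) = f (\<lambda>_. 0)"
proof -
  interpret Q: comm_group "cyclic_sum N" by (rule comm_group_cyclic_sum)
  define d where "d = unit_vector N r [^]\<^bsub>cyclic_sum N\<^esub> t"
  have d: "d \<in> carrier (cyclic_sum N)" by (simp add: d_def unit_vector_carrier)
  have d_pow: "d [^]\<^bsub>cyclic_sum N\<^esub> k = (\<lambda>j. if j = r then int (k * t) mod int N else 0)" for k :: nat
  proof -
    have "d [^]\<^bsub>cyclic_sum N\<^esub> k = unit_vector N r [^]\<^bsub>cyclic_sum N\<^esub> (k * t)"
      by (simp add: d_def Q.nat_pow_pow unit_vector_carrier mult.commute)
    then show ?thesis by (auto simp: cyclic_sum_pow unit_vector_def fun_eq_iff mod_mult_right_eq)
  qed
  have sparse: "f (d [^]\<^bsub>cyclic_sum N\<^esub> k) = \<one>\<^bsub>A\<^esub>" if k: "0 < k" "k < n" for k :: nat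
  proof (rule ccontr)
    assume "f (d [^]\<^bsub>cyclic_sum N\<^esub> k) \<noteq> \<one>\<^bsub>A\<^esub>"
    then have "(d [^]\<^bsub>cyclic_sum N\<^esub> k) r = 0"
      using f(2) d by (auto simp: supported_below_def)
    moreover have "k * t < N" using k N by simp
    ultimately have "k * t = 0" unfolding d_pow by (simp flip: of_nat_mult zmod_int)
    then show False using k N by simp
  qed
  obtain F where F: "F \<in> carrier (cyclic_sum N) \<rightarrow>\<^sub>E carrier A"
    "conj_norm (A Wr cyclic_sum N) n (\<lambda>x\<in>carrier (cyclic_sum N). \<one>\<^bsub>A\<^esub>, d)
      (f, \<one>\<^bsub>cyclic_sum N\<^esub>) = (F, \<one>\<^bsub>cyclic_sum N\<^esub>)"
    "F \<one>\<^bsub>cyclic_sum N\<^esub> = f \<one>\<^bsub>cyclic_sum N\<^esub>"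
    "\<And>x. x \<in> carrier (cyclic_sum N) \<Longrightarrow> F x \<noteq> \<one>\<^bsub>A\<^esub> \<Longrightarrow>
      \<exists>k<n. f (x \<otimes>\<^bsub>cyclic_sum N\<^esub> d [^]\<^bsub>cyclic_sum N\<^esub> k) \<noteq> \<one>\<^bsub>A\<^esub>"
    by (rule conj_norm_spread[OF A Q.is_group d f(1) N(2)], erule (1) sparse, blast)
  have "x j = 0" if x: "x \<in> carrier (cyclic_sum N)" and ne: "F x \<noteq> \<one>\<^bsub>A\<^esub>" and j: "j \<ge> Suc r" for x j
  proof -
    obtain k where k: "k < n" "f (x \<otimes>\<^bsub>cyclic_sum N\<^esub> d [^]\<^bsub>cyclic_sum N\<^esub> k) \<noteq> \<one>\<^bsub>A\<^esub>"
      using F(4)[OF x ne] by blast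
    have "x \<otimes>\<^bsub>cyclic_sum N\<^esub> d [^]\<^bsub>cyclic_sum N\<^esub> k \<in> carrier (cyclic_sum N)" using x d by blast
    then have "(x \<otimes>\<^bsub>cyclic_sum N\<^esub> d [^]\<^bsub>cyclic_sum N\<^esub> k) j = 0"
      using f(2) k(2) j unfolding supported_below_def by (meson Suc_leD)
    then have "x j mod int N = 0" using j by (simp add: d_pow)
    moreover have "x j \<in> {0..<int N}"
      using x N by (auto simp: carrier_cyclic_sum carrier_integer_mod_group)
    ultimately show ?thesis by simp
  qed
  then have "supported_below N A (Suc r) F" by (auto simp: supported_below_def)
  with F show thesis using that by (simp add: d_def)
qed

lemma wreath_top_pow:
  assumes "group A" "group B" "b \<in> carrier B"
  shows "(\<lambda>x\<in>carrier B. \<one>\<^bsub>A\<^esub>, b) [^]\<^bsub>A Wr B\<^esub> (k :: nat) = (\<lambda>x\<in>carrier B. \<one>\<^bsub>A\<^esub>, b [^]\<^bsub>B\<^esub> k)"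
proof -
  interpret A: group A by fact
  interpret B: group B by fact
  interpret W: group "A Wr B" by (rule group_wreath_product) fact+
  show ?thesis using assms(3) by (induction k) (auto simp: one_wreath restrict_def)
qed

text \<open>Assign to variable \<open>i\<close> the \<open>i\<close>-th unit vector of the top group, and for \<open>i = 0\<close> multiply it by a
  function supported at the zero vector. Each further norm uses a new coordinate, so the value at
  the zero vector remains the same nontrivial element \<open>a\<close>.\<close>

lemma norm_law_fails:
  fixes A :: "('a, 'm) monoid_scheme"
  assumes A: "group A" "\<not> trivial_group A" and pq: "p > 0" "q > 0" "p * q > 1"
  shows "\<not> satisfies (A Wr cyclic_sum (p * q)) {norm_law p q m}"
proof -
  interpret A: group A by fact
  let ?N = "p * q"
  let ?Q = "cyclic_sum ?N"
  interpret Q: comm_group ?Q by (rule comm_group_cyclic_sum)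
  interpret W: group "A Wr ?Q" by (rule group_wreath_product[OF A(1) Q.is_group])
  obtain a where a: "a \<in> carrier A" "a \<noteq> \<one>\<^bsub>A\<^esub>"
    using A(2) A.trivial_group_subset by auto
  have zero: "(\<lambda>_. 0) \<in> carrier ?Q" using Q.one_closed by simp
  define f where "f = (\<lambda>x\<in>carrier ?Q. if x = (\<lambda>_. 0) then a else \<one>\<^bsub>A\<^esub>)"
  have f: "f \<in> carrier ?Q \<rightarrow>\<^sub>E carrier A" "supported_below ?N A 0 f" "f (\<lambda>_. 0) = a"
    using a(1) zero by (auto simp: f_def supported_below_def)
  define t where "t = (\<lambda>i. (\<lambda>x\<in>carrier ?Q. \<one>\<^bsub>A\<^esub>, unit_vector ?N i))"
  have t: "t i \<in> carrier (A Wr ?Q)" for i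
    by (auto simp: t_def carrier_wreath unit_vector_carrier)
  have t_pow: "t i [^]\<^bsub>A Wr ?Q\<^esub> (k :: nat) =
      (\<lambda>x\<in>carrier ?Q. \<one>\<^bsub>A\<^esub>, unit_vector ?N i [^]\<^bsub>?Q\<^esub> k)" for i k
    unfolding t_def by (rule wreath_top_pow[OF A(1) Q.is_group unit_vector_carrier])
  have f0: "(f, \<lambda>_. 0) \<in> carrier (A Wr ?Q)" using f(1) zero by (simp add: carrier_wreath)
  define s where "s = (\<lambda>i. if i = 0 then (f, \<lambda>_. 0) \<otimes>\<^bsub>A Wr ?Q\<^esub> t 0 else t i)"
  have s: "s \<in> UNIV \<rightarrow> carrier (A Wr ?Q)" using t f0 by (auto simp: s_def)
  have s_Suc: "s (Suc k) = t (Suc k)" for k by (simp add: s_def)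
  have "\<exists>F. F \<in> carrier ?Q \<rightarrow>\<^sub>E carrier A \<and> supported_below ?N A (Suc m) F \<and> F (\<lambda>_. 0) = a \<and>
      eval_word (A Wr ?Q) s (norm_law p q m) = (F, \<lambda>_. 0)" for m
  proof (induction m)
    case 0
    \<comment> \<open>This makes \<open>s 0 [^] N = (f t) [^] N\<close> the norm of \<open>f\<close> along \<open>t\<close>.\<close>
    have "t 0 [^]\<^bsub>A Wr ?Q\<^esub> ?N = \<one>\<^bsub>A Wr ?Q\<^esub>"
      by (simp only: t_pow) (auto simp: one_wreath cyclic_sum_pow)
    then have "s 0 [^]\<^bsub>A Wr ?Q\<^esub> ?N = conj_norm (A Wr ?Q) ?N (t 0 [^]\<^bsub>A Wr ?Q\<^esub> (1::nat)) (f, \<lambda>_. 0)"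
      using t f0 by (simp add: conj_norm_def s_def)
    moreover obtain F where "F \<in> carrier ?Q \<rightarrow>\<^sub>E carrier A" "supported_below ?N A (Suc 0) F"
      "conj_norm (A Wr ?Q) ?N (t 0 [^]\<^bsub>A Wr ?Q\<^esub> (1::nat)) (f, \<lambda>_. 0) = (F, \<lambda>_. 0)" "F (\<lambda>_. 0) = a"
      using conj_norm_unit_vector[OF A(1) _ _ _ pq(3) f(1,2), of ?N 1] pq f(3) unfolding t_pow by auto
    ultimately show ?case by (auto simp: W.eval_norm_law[OF s])
  next
    case (Suc m)
    then obtain F where F: "F \<in> carrier ?Q \<rightarrow>\<^sub>E carrier A" "supported_below ?N A (Suc m) F"
      "F (\<lambda>_. 0) = a" "eval_word (A Wr ?Q) s (norm_law p q m) = (F, \<lambda>_. 0)" by blast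
    have "eval_word (A Wr ?Q) s (norm_law p q (Suc m)) =
        conj_norm (A Wr ?Q) p (t (Suc m) [^]\<^bsub>A Wr ?Q\<^esub> q) (eval_word (A Wr ?Q) s (norm_law p q m))"
      by (simp add: W.eval_norm_law[OF s] s_Suc)
    moreover obtain F' where "F' \<in> carrier ?Q \<rightarrow>\<^sub>E carrier A" "supported_below ?N A (Suc (Suc m)) F'"
      "conj_norm (A Wr ?Q) p (t (Suc m) [^]\<^bsub>A Wr ?Q\<^esub> q) (F, \<lambda>_. 0) = (F', \<lambda>_. 0)" "F' (\<lambda>_. 0) = a"
      using conj_norm_unit_vector[OF A(1) _ pq(1,2,3) F(1,2)] F(3) unfolding t_pow by auto
    ultimately show ?case using F(4) by auto
  qed
  then obtain F where "F (\<lambda>_. 0) = a" "eval_word (A Wr ?Q) s (norm_law p q m) = (F, \<lambda>_. 0)"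
    by blast
  then have "eval_word (A Wr ?Q) s (norm_law p q m) \<noteq> \<one>\<^bsub>A Wr ?Q\<^esub>"
    using a(2) zero by (auto simp: one_wreath)
  then show ?thesis using s by (auto simp: satisfies_singleton)
qed

section \<open>Finding an infinite sum of cyclic groups\<close>

lemma (in comm_group) finite_subgroup_adjoin:
  assumes S: "subgroup S G" "finite S" and d: "d \<in> carrier G" "d [^] (p :: nat) = \<one>" "p > 0"
  obtains T where "subgroup T G" "finite T" "S \<subseteq> T" "d \<in> T"
proof -
  have C: "subgroup (generate G {d}) G" using d(1) by (intro generate_is_subgroup) simp
  have "x \<in> (\<lambda>k. d [^] k) ` {..<p}" if x: "x \<in> generate G {d}" for x
  proof -
    obtain k :: int where k: "x = d [^] k" using x generate_pow[OF d(1)] by blast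
    have "k = int p * (k div int p) + int (nat (k mod int p))"
      using d(3) by simp
    then have "x = (d [^] int p) [^] (k div int p) \<otimes> d [^] int (nat (k mod int p))"
      using d(1) by (metis k int_pow_mult int_pow_pow)
    then have "x = d [^] nat (k mod int p)"
      using d by (simp add: int_pow_int)
    moreover have "nat (k mod int p) < p" using d(3) by (simp add: nat_less_iff)
    ultimately show ?thesis by blast
  qed
  then have "finite (generate G {d})" by (meson finite_surj finite_lessThan subsetI)
  then have "finite (S <#> generate G {d})" using S(2) by (simp add: set_mult_def)
  moreover have "subgroup (S <#> generate G {d}) G" using S(1) C by (rule mult_subgroups)
  moreover have "S \<subseteq> S <#> generate G {d}"
  proof
    fix x assume "x \<in> S"
    then have "x \<otimes> \<one> \<in> S <#> generate G {d}"
      unfolding set_mult_def using subgroup.one_closed[OF C] by blast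
    then show "x \<in> S <#> generate G {d}"
      using \<open>x \<in> S\<close> subgroup.mem_carrier[OF S(1)] by simp
  qed
  moreover have "d \<in> S <#> generate G {d}"
  proof -
    have "\<one> \<otimes> d \<in> S <#> generate G {d}"
      unfolding set_mult_def using subgroup.one_closed[OF S(1)] generate.incl[of d "{d}" G] by blast
    then show ?thesis using d(1) by simp
  qed
  ultimately show thesis using that by blast
qed

text \<open>Finite subgroups \<open>E i\<close> are enlarged step by step by a \<open>q\<close>-th power outside of them; infinitely
  many \<open>q\<close>-th powers leave one to choose at each step.\<close>

lemma (in comm_group) independent_powers:
  assumes inf: "infinite ((\<lambda>x. x [^] (q::nat)) ` carrier G)"
    and pq: "\<And>x. x \<in> carrier G \<Longrightarrow> x [^] (p * q) = \<one>" and p: "p > 0"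
  shows "\<exists>b E. \<forall>i::nat. b i \<in> carrier G \<and> subgroup (E i) G \<and> b i [^] q \<notin> E i \<and>
    (\<forall>j>i. b i [^] q \<in> E j)"
proof -
  let ?P = "\<lambda>(S, x). subgroup S G \<and> finite S \<and> x \<in> carrier G \<and> x [^] q \<notin> S"
  let ?R = "\<lambda>(S, x) (T, y). S \<subseteq> T \<and> x [^] q \<in> T"
  have "\<exists>f. \<forall>n::nat. ?P (f n) \<and> ?R (f n) (f (Suc n))"
  proof (rule dependent_nat_choice, goal_cases)
    have pick: "\<exists>x\<in>carrier G. x [^] q \<notin> S" if "finite S" for S
      using inf that by (meson finite_subset image_subsetI)
    case 1
    then show ?case
      using pick[of "{\<one>}"] triv_subgroup by auto
    case (2 a n)
    obtain S x where a: "a = (S, x)" "subgroup S G" "finite S" "x \<in> carrier G" "x [^] q \<notin> S"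
      using 2 by (cases a) auto
    have "(x [^] q) [^] p = \<one>" using pq[OF a(4)] a(4) by (simp add: nat_pow_pow mult.commute)
    then obtain T where T: "subgroup T G" "finite T" "S \<subseteq> T" "x [^] q \<in> T"
      using finite_subgroup_adjoin[OF a(2,3) _ _ p, of "x [^] q"] a(4) by auto
    obtain y where "y \<in> carrier G" "y [^] q \<notin> T" using pick[OF T(2)] by blast
    with T show ?case by (intro exI[of _ "(T, y)"]) (simp add: a(1))
  qed
  then obtain f where f: "\<forall>n::nat. ?P (f n) \<and> ?R (f n) (f (Suc n))" by (elim exE)
  define E where "E n = fst (f n)" for n
  define b where "b n = snd (f n)" for n
  have E: "subgroup (E n) G" "b n \<in> carrier G" "b n [^] q \<notin> E n"
    "E n \<subseteq> E (Suc n)" "b n [^] q \<in> E (Suc n)" for n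
    using f[rule_format, of n] by (auto simp: E_def b_def split: prod.splits)
  have "b i [^] q \<in> E j" if "i < j" for i j
    using that E(5)[of i] lift_Suc_mono_le[of E "Suc i" j] E(4) by (auto simp: Suc_le_eq)
  with E show ?thesis by (intro exI[of _ b] exI[of _ E]) simp
qed

lemma (in group) pow_in_subgroup_coprime:
  assumes "subgroup S G" "d \<in> carrier G" "d [^] (p::nat) = \<one>" "prime p"
    and c: "d [^] (c::nat) \<in> S" "\<not> p dvd c"
  shows "d \<in> S"
proof -
  have "coprime c p" using assms(4) c(2) prime_imp_coprime coprime_commute by blast
  moreover have "c \<noteq> 0" using c(2) by (metis dvd_0_right)
  ultimately obtain x y where xy: "c * x = p * y + 1" using bezout_nat[of c p] by auto
  have "(d [^] c) [^] x = (d [^] p) [^] y \<otimes> d"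
    using assms(2) xy by (simp add: nat_pow_pow)
  then have "d = (d [^] c) [^] x" using assms(2,3) by simp
  moreover have "(d [^] c) [^] k \<in> S" for k :: nat
    using c(1) assms(1) by (induction k) (auto simp: subgroup.one_closed subgroup.m_closed)
  ultimately show ?thesis by metis
qed

text \<open>The \<open>b i\<close> with independent \<open>q\<close>-th powers define a homomorphism from the infinite sum. A nontrivial
  kernel would contain an element \<open>y\<close> of order \<open>p\<close>. Its coordinates are divisible by \<open>q\<close>, so \<open>\<phi> y = \<one>\<close>
  is a relation between the \<open>q\<close>-th powers of the \<open>b i\<close>, and the last one that occurs would lie in the
  subgroup of the earlier ones.\<close>

lemma contains_cyclic_sum:
  fixes B :: "('b, 'm) monoid_scheme"
  assumes "comm_group B" "prime p" and pq: "\<And>x. x \<in> carrier B \<Longrightarrow> x [^]\<^bsub>B\<^esub> (p ^ Suc l) = \<one>\<^bsub>B\<^esub>"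
    and inf: "infinite ((\<lambda>x. x [^]\<^bsub>B\<^esub> (p ^ l)) ` carrier B)"
  shows "\<exists>H. subgroup H B \<and> B\<lparr>carrier := H\<rparr> \<cong> cyclic_sum (p ^ Suc l)"
proof -
  interpret B: comm_group B by fact
  define N where "N = p ^ Suc l"
  define q where "q = p ^ l"
  have N: "N = p * q" "q > 0" "N > 0" using prime_gt_0_nat[OF assms(2)] by (auto simp: N_def q_def)
  interpret Q: comm_group "cyclic_sum N" by (rule comm_group_cyclic_sum)
  have inf': "infinite ((\<lambda>x. x [^]\<^bsub>B\<^esub> q) ` carrier B)" using inf by (simp add: q_def)
  have pq': "x [^]\<^bsub>B\<^esub> (p * q) = \<one>\<^bsub>B\<^esub>" if "x \<in> carrier B" for x
    using pq[OF that] by (simp add: q_def)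
  obtain b E where bE: "\<forall>i::nat. b i \<in> carrier B \<and> subgroup (E i) B \<and> b i [^]\<^bsub>B\<^esub> q \<notin> E i \<and>
      (\<forall>j>i. b i [^]\<^bsub>B\<^esub> q \<in> E j)"
    using B.independent_powers[of q p, OF inf' pq' prime_gt_0_nat[OF assms(2)]] by blast
  have b: "\<And>i. b i \<in> carrier B" and E: "\<And>i. subgroup (E i) B"
    "\<And>i j. i < j \<Longrightarrow> b i [^]\<^bsub>B\<^esub> q \<in> E j" "\<And>i. b i [^]\<^bsub>B\<^esub> q \<notin> E i"
    using bE by blast+
  have bN: "b i [^]\<^bsub>B\<^esub> int N = \<one>\<^bsub>B\<^esub>" for i
    using pq[OF b, of i] unfolding N_def int_pow_int .
  have hom: "(\<lambda>k. b i [^]\<^bsub>B\<^esub> k) \<in> hom (integer_mod_group N) B" for i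
  proof (rule homI)
    fix k j :: int
    have "k + j = int N * ((k + j) div int N) + (k + j) mod int N" by simp
    then have "b i [^]\<^bsub>B\<^esub> (k + j) = (b i [^]\<^bsub>B\<^esub> int N) [^]\<^bsub>B\<^esub> ((k + j) div int N) \<otimes>\<^bsub>B\<^esub> b i [^]\<^bsub>B\<^esub> ((k + j) mod int N)"
      using b by (metis B.int_pow_mult B.int_pow_pow)
    then have "b i [^]\<^bsub>B\<^esub> ((k + j) mod int N) = b i [^]\<^bsub>B\<^esub> (k + j)"
      using b by (simp add: bN)
    then show "b i [^]\<^bsub>B\<^esub> (k \<otimes>\<^bsub>integer_mod_group N\<^esub> j) = b i [^]\<^bsub>B\<^esub> k \<otimes>\<^bsub>B\<^esub> b i [^]\<^bsub>B\<^esub> j"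
      using b by (simp add: B.int_pow_mult)
  qed (use b in simp)
  define \<phi> where "\<phi> x = gfinprod B (\<lambda>i. b i [^]\<^bsub>B\<^esub> (x i :: int)) UNIV" for x
  have "\<phi> \<in> hom (cyclic_sum N) B"
    unfolding \<phi>_def cyclic_sum_def using hom by (intro B.hom_group_sum) auto
  then interpret \<phi>: group_hom "cyclic_sum N" B \<phi> by unfold_locales
  have socle: "y = \<one>\<^bsub>cyclic_sum N\<^esub>"
    if y: "y \<in> carrier (cyclic_sum N)" "y [^]\<^bsub>cyclic_sum N\<^esub> p = \<one>\<^bsub>cyclic_sum N\<^esub>" "\<phi> y = \<one>\<^bsub>B\<^esub>" for y
  proof (rule ccontr)
    assume "y \<noteq> \<one>\<^bsub>cyclic_sum N\<^esub>"
    then have ne: "{i. y i \<noteq> 0} \<noteq> {}" by auto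
    have fin: "finite {i. y i \<noteq> 0}" and yN: "\<And>i. 0 \<le> y i \<and> y i < int N"
      using y(1) N by (auto simp: carrier_cyclic_sum carrier_integer_mod_group)
    define c where "c i = nat (y i div int q)" for i
    have c: "y i = int (q * c i)" "c i < p" for i
    proof -
      have "(int p * y i) mod int N = 0"
        using fun_cong[OF y(2), of i] by (simp add: cyclic_sum_pow)
      then have "int N dvd int p * y i" by (rule mod_0_imp_dvd)
      then have "int p * int q dvd int p * y i" by (simp only: N(1) of_nat_mult)
      then have "int q dvd y i" using prime_gt_0_nat[OF assms(2)] by simp
      then show "y i = int (q * c i)" using yN[of i] N(2) by (simp add: c_def pos_imp_zdiv_nonneg_iff)
      then have "int (q * c i) < int (p * q)" using yN[of i] by (simp add: N(1))
      then have "q * c i < q * p" unfolding of_nat_less_iff by (simp add: mult.commute)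
      then show "c i < p" by simp
    qed
    have pow: "b i [^]\<^bsub>B\<^esub> y i = (b i [^]\<^bsub>B\<^esub> q) [^]\<^bsub>B\<^esub> c i" for i
      using b unfolding c(1)[of i] int_pow_int by (simp add: B.nat_pow_pow)
    define m where "m = Max {i. y i \<noteq> 0}"
    have m: "y m \<noteq> 0" "\<And>i. y i \<noteq> 0 \<Longrightarrow> i \<le> m"
      using Max_in[OF fin ne] Max_ge[OF fin] by (auto simp: m_def)
    have cl: "(\<lambda>i. b i [^]\<^bsub>B\<^esub> y i) \<in> A \<rightarrow> carrier B" for A using b by auto
    have "\<phi> y = finprod B (\<lambda>i. b i [^]\<^bsub>B\<^esub> y i) {..m}"
    proof -
      have "\<phi> y = gfinprod B (\<lambda>i. b i [^]\<^bsub>B\<^esub> y i) {..m}"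
        unfolding \<phi>_def
      proof (rule B.gfinprod_mono_neutral_cong_right)
        show "b i [^]\<^bsub>B\<^esub> y i = \<one>\<^bsub>B\<^esub>" if "i \<in> UNIV - {..m}" for i
          using that m(2)[of i] by (cases "y i = 0") auto
      qed (use b in auto)
      then show ?thesis using cl by simp
    qed
    also have "{..m} = insert m {..<m}" by auto
    also have "finprod B (\<lambda>i. b i [^]\<^bsub>B\<^esub> y i) (insert m {..<m}) =
        b m [^]\<^bsub>B\<^esub> y m \<otimes>\<^bsub>B\<^esub> finprod B (\<lambda>i. b i [^]\<^bsub>B\<^esub> y i) {..<m}"
      using b by (intro B.finprod_insert) auto
    finally have eq: "b m [^]\<^bsub>B\<^esub> y m \<otimes>\<^bsub>B\<^esub> finprod B (\<lambda>i. b i [^]\<^bsub>B\<^esub> y i) {..<m} = \<one>\<^bsub>B\<^esub>"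
      using y(3) by simp
    interpret Em: subgroup "E m" B by (rule E(1))
    have powE: "x [^]\<^bsub>B\<^esub> (k::nat) \<in> E m" if "x \<in> E m" for x k
      using that by (induction k) auto
    have "finprod B (\<lambda>i. b i [^]\<^bsub>B\<^esub> y i) {..<k} \<in> E m" if "k \<le> m" for k
      using that
    proof (induction k)
      case (Suc k)
      have "finprod B (\<lambda>i. b i [^]\<^bsub>B\<^esub> y i) {..<Suc k} =
          b k [^]\<^bsub>B\<^esub> y k \<otimes>\<^bsub>B\<^esub> finprod B (\<lambda>i. b i [^]\<^bsub>B\<^esub> y i) {..<k}"
        unfolding lessThan_Suc using b by (intro B.finprod_insert) auto
      moreover have "b k [^]\<^bsub>B\<^esub> y k \<in> E m"
        unfolding pow using Suc.prems by (intro powE E(2)) simp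
      ultimately show ?case using Suc by simp
    qed simp
    then have "finprod B (\<lambda>i. b i [^]\<^bsub>B\<^esub> y i) {..<m} \<in> E m" by simp
    then have "inv\<^bsub>B\<^esub> (finprod B (\<lambda>i. b i [^]\<^bsub>B\<^esub> y i) {..<m}) \<in> E m" by (rule Em.m_inv_closed)
    moreover have "b m [^]\<^bsub>B\<^esub> y m = inv\<^bsub>B\<^esub> (finprod B (\<lambda>i. b i [^]\<^bsub>B\<^esub> y i) {..<m})"
      using eq b cl by (intro B.inv_equality[symmetric]) auto
    ultimately have "(b m [^]\<^bsub>B\<^esub> q) [^]\<^bsub>B\<^esub> c m \<in> E m" by (simp add: pow)
    moreover have "(b m [^]\<^bsub>B\<^esub> q) [^]\<^bsub>B\<^esub> p = \<one>\<^bsub>B\<^esub>"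
      using pq[OF b, of m] b by (simp add: B.nat_pow_pow q_def mult.commute)
    moreover have "\<not> p dvd c m"
      using c[of m] m(1) by (auto dest: dvd_imp_le)
    ultimately have "b m [^]\<^bsub>B\<^esub> q \<in> E m"
      using B.pow_in_subgroup_coprime[OF E(1) _ _ assms(2)] b by blast
    then show False using E(3) by blast
  qed
  have kernel: "x = \<one>\<^bsub>cyclic_sum N\<^esub>" if x: "x \<in> carrier (cyclic_sum N)" "\<phi> x = \<one>\<^bsub>B\<^esub>" for x
  proof -
    have "x [^]\<^bsub>cyclic_sum N\<^esub> (p ^ k) = \<one>\<^bsub>cyclic_sum N\<^esub> \<Longrightarrow> x = \<one>\<^bsub>cyclic_sum N\<^esub>" for k
    proof (induction k)
      case (Suc k)
      have "x [^]\<^bsub>cyclic_sum N\<^esub> (p ^ k) = \<one>\<^bsub>cyclic_sum N\<^esub>"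
      proof (rule socle)
        show "(x [^]\<^bsub>cyclic_sum N\<^esub> (p ^ k)) [^]\<^bsub>cyclic_sum N\<^esub> p = \<one>\<^bsub>cyclic_sum N\<^esub>"
          using Suc.prems x(1) by (simp only: Q.nat_pow_pow power_Suc mult.commute)
        show "\<phi> (x [^]\<^bsub>cyclic_sum N\<^esub> (p ^ k)) = \<one>\<^bsub>B\<^esub>"
          using x by (simp only: \<phi>.hom_nat_pow B.nat_pow_one)
      qed (use x in blast)
      then show ?case by (rule Suc.IH)
    next
      case 0
      then show ?case using x(1) by (simp only: power_0 Q.nat_pow_eone)
    qed
    from this[of "Suc l"] show ?thesis by (simp add: cyclic_sum_pow N_def)
  qed
  then have inj: "inj_on \<phi> (carrier (cyclic_sum N))" by (simp add: \<phi>.inj_on_one_iff)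
  define H where "H = \<phi> ` carrier (cyclic_sum N)"
  have H: "subgroup H B" unfolding H_def by (rule \<phi>.img_is_subgroup)
  have "\<phi> \<in> iso (cyclic_sum N) (B\<lparr>carrier := H\<rparr>)"
    using inj by (auto simp: iso_def hom_def H_def bij_betw_def simp del: mult_cyclic_sum)
  then have "cyclic_sum N \<cong> B\<lparr>carrier := H\<rparr>" by (auto simp: is_iso_def)
  then have "B\<lparr>carrier := H\<rparr> \<cong> cyclic_sum N" by (rule Q.iso_sym)
  with H show ?thesis by (auto simp: N_def)
qed

section \<open>The criterion\<close>

text \<open>The exponent of a \<open>p\<close>-group is a power of \<open>p\<close>; the crude bound \<open>p ^ n\<close> for it suffices.\<close>

lemma p_group_exponent:
  assumes "p_group p A" "has_exponent A n" "prime p" "x \<in> carrier A"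
  shows "x [^]\<^bsub>A\<^esub> (p ^ n) = \<one>\<^bsub>A\<^esub>"
proof -
  interpret A: group A using assms(1) by (simp add: p_group_def)
  obtain k where "x [^]\<^bsub>A\<^esub> (p ^ k) = \<one>\<^bsub>A\<^esub>" using assms(1,4) by (auto simp: p_group_def)
  then have "A.ord x dvd p ^ k" using assms(4) by (simp add: A.pow_eq_id)
  then obtain j where j: "A.ord x = p ^ j" using divides_primepow_nat[OF assms(3)] by auto
  have "x [^]\<^bsub>A\<^esub> n = \<one>\<^bsub>A\<^esub>" "n > 0" using assms(2,4) by (auto simp: has_exponent_def)
  then have "p ^ j \<le> n" using assms(4) j by (simp add: A.pow_eq_id dvd_imp_le)
  moreover have "j < p ^ j" using prime_gt_1_nat[OF assms(3)] by (simp add: power_gt_expt)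
  ultimately have "p ^ j dvd p ^ n" by (intro le_imp_power_dvd) simp
  then show ?thesis using assms(4) j by (simp add: A.pow_eq_id)
qed

lemma product_laws_cong:
  assumes "\<And>w. satisfies B {w} \<longleftrightarrow> satisfies C {w}"
  shows "product_laws A B = product_laws A C"
  using assms by (simp add: product_laws_def)

lemma has_exponent_cyclic_sum:
  assumes "n > 0"
  shows "has_exponent (cyclic_sum n) n"
  unfolding has_exponent_def
proof (intro conjI allI impI ballI)
  fix m :: nat assume m: "0 < m" "\<forall>x\<in>carrier (cyclic_sum n). x [^]\<^bsub>cyclic_sum n\<^esub> m = \<one>\<^bsub>cyclic_sum n\<^esub>"
  then have "(int m * unit_vector n 0 0) mod int n = 0"
    using unit_vector_carrier[of n 0] by (auto simp: cyclic_sum_pow dest!: bspec fun_cong[of _ _ 0])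
  then have "int m mod int n = 0" by (simp add: unit_vector_def mod_mult_right_eq)
  then have "int n dvd int m" by (rule mod_0_imp_dvd)
  then show "n \<le> m" using m(1) by (simp add: dvd_imp_le)
qed (use assms in \<open>auto simp: cyclic_sum_pow\<close>)

theorem theorem1:
  fixes p v :: nat
    and A :: "('a, 'm1) monoid_scheme"
    and B :: "('b, 'm2) monoid_scheme"
  assumes "prime p"
    and "nilpotent_group A" "p_group p A" "\<exists>n. has_exponent A n" "\<not> trivial_group A"
    and "comm_group B" "has_exponent B (p ^ v)" "\<not> trivial_group B"
    and "infinite (UNIV :: 'u set)"
  shows "(product_variety (var_gen A) (var_gen B) :: 'u monoid set) =
           product_variety (var_gen A) (abelian_variety (p ^ v))
       \<and> ((var_gen (A Wr B) :: 'u monoid set) = product_variety (var_gen A) (var_gen B)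
          \<longleftrightarrow> (\<exists>H. subgroup H B \<and>
                B\<lparr>carrier := H\<rparr> \<cong> sum_group (UNIV :: nat set) (\<lambda>_. integer_mod_group (p ^ v))))"
proof (intro conjI iffI)
  interpret A: group A using assms(2) by (simp add: nilpotent_group_def)
  interpret B: comm_group B by fact
  interpret W: group "A Wr B" by (rule group_wreath_product[OF A.is_group B.is_group])
  have product: "(product_variety (var_gen A) (var_gen B) :: 'u monoid set) = variety (product_laws A B)"
    by (rule product_variety_eq_variety[OF B.is_group])
  show "(product_variety (var_gen A) (var_gen B) :: 'u monoid set) =
      product_variety (var_gen A) (abelian_variety (p ^ v))"
    by (simp add: var_gen_abelian[OF assms(6,7)])
  {
    assume "\<exists>H. subgroup H B \<and>
      B\<lparr>carrier := H\<rparr> \<cong> sum_group (UNIV :: nat set) (\<lambda>_. integer_mod_group (p ^ v))"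
    then obtain b where b: "b \<in> UNIV \<rightarrow> carrier B"
      and free: "\<And>u. eval_word B b u = \<one>\<^bsub>B\<^esub> \<Longrightarrow> satisfies B {u}"
      using free_sequence_if_contains_cyclic_sum[OF assms(6,7)] unfolding cyclic_sum_def by metis
    have "G \<in> var_gen (A Wr B) \<longleftrightarrow> G \<in> variety (product_laws A B)" for G :: "'u monoid"
    proof
      assume "G \<in> var_gen (A Wr B)"
      then show "G \<in> variety (product_laws A B)"
        using wreath_satisfies_product_laws[OF A.is_group B.is_group]
        unfolding variety_def var_gen_iff by (auto simp: satisfies_iff_singletons[of _ "product_laws A B"])
    next
      assume "G \<in> variety (product_laws A B)"
      then show "G \<in> var_gen (A Wr B)"
        using wreath_law_in_product_variety[OF A.is_group B.is_group _ b free]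
        unfolding variety_def var_gen_iff by blast
    qed
    then show "(var_gen (A Wr B) :: 'u monoid set) = product_variety (var_gen A) (var_gen B)"
      unfolding product by blast
  }
  {
    assume eq: "(var_gen (A Wr B) :: 'u monoid set) = product_variety (var_gen A) (var_gen B)"
    have "v \<noteq> 0"
    proof
      assume "v = 0"
      then have "carrier B \<subseteq> {\<one>\<^bsub>B\<^esub>}" using assms(7) by (auto simp: has_exponent_def)
      then show False using assms(8) B.trivial_group_subset by blast
    qed
    then obtain l where l: "v = Suc l" by (cases v) auto
    have p: "p > 1" using assms(1) by (rule prime_gt_1_nat)
    have pl: "x [^]\<^bsub>B\<^esub> (p * p ^ l) = \<one>\<^bsub>B\<^esub>" if "x \<in> carrier B" for x
      using assms(7) that by (simp add: has_exponent_def l)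
    have "infinite ((\<lambda>x. x [^]\<^bsub>B\<^esub> (p ^ l)) ` carrier B)"
    proof
      assume fin: "finite ((\<lambda>x. x [^]\<^bsub>B\<^esub> (p ^ l)) ` carrier B)"
      obtain n where "has_exponent A n" using assms(4) by blast
      then obtain m where m: "satisfies (A Wr B) {norm_law p (p ^ l) m}"
        using norm_law_holds[OF assms(2) p_group_exponent[OF assms(3) _ assms(1)] assms(6) pl fin] by blast
      let ?Q = "cyclic_sum (p ^ v)"
      interpret Q: comm_group ?Q by (rule comm_group_cyclic_sum)
      have "product_laws A ?Q = product_laws A B"
        using p by (intro product_laws_cong)
          (simp add: abelian_law_iff[OF assms(6,7)] abelian_law_iff[OF comm_group_cyclic_sum has_exponent_cyclic_sum])
      then have "satisfies (A Wr ?Q) (product_laws A B)"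
        using wreath_satisfies_product_laws[OF A.is_group Q.is_group] by simp
      moreover have "satisfies H {norm_law p (p ^ l) m}"
        if "group H" "satisfies H (product_laws A B)" for H :: "'u monoid"
      proof -
        have "H \<in> var_gen (A Wr B)" using that unfolding eq product by (simp add: variety_def)
        then show ?thesis using m by (simp add: var_gen_iff)
      qed
      ultimately have "satisfies (A Wr ?Q) {norm_law p (p ^ l) m}"
        using satisfies_if_on_infinite_type[OF assms(9) group_wreath_product[OF A.is_group Q.is_group]]
        by blast
      moreover have "p * p ^ l > 1" using p by (metis one_less_power power_Suc zero_less_Suc)
      ultimately show False
        using norm_law_fails[OF A.is_group assms(5), of p "p ^ l" m] p by (simp add: l)
    qed
    then show "\<exists>H. subgroup H B \<and>
        B\<lparr>carrier := H\<rparr> \<cong> sum_group (UNIV :: nat set) (\<lambda>_. integer_mod_group (p ^ v))"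
      using contains_cyclic_sum[OF assms(6,1)] pl unfolding l cyclic_sum_def by simp
  }
qed

end
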